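(* Let $G=\mathrm{PGL}_2(\mathbb{R})$, $\Gamma=\mathrm{PGL}_2(\mathbb{Z})$, $K=\mathrm{PSO}(2,\mathbb{R})$, and let $\phi$ be a Hecke–Maass cusp form for $\Gamma$ (a right $K$-invariant cuspidal function on $\Gamma\backslash G$ which is an eigenfunction of the Laplace–Beltrami operator and of all Hecke operators), normalized to have $L^2$-norm $1$. Let $\pi_\tau$ be the principal series representation of $G$ isomorphic to the representation generated by $\phi$ under right translations, realized in the circle model with orthonormal basis $e_n(\theta)=e^{in\theta}$, $n\in 2\mathbb{Z}$, and let $\nu:V_{\pi_\tau}\to C^\infty(\Gamma\backslash G)$ be the $G$-equivariant embedding with $\nu(e_0)=\phi$. Put $a_n=\nu(e_n)(e)$, so that $\phi(g)=\sum_{n\in2\mathbb{Z}}a_n\langle\pi_\tau(g)e_0,e_n\rangle$. Let $$D_E(\phi,w)=a_0+\sum_{n\in 2\mathbb{Z}\setminus\{0\}}a_n|n|^{-w}\quad(\mathrm{Re}(w)\gg1),\qquad \tilde D_E(\phi,w)=\frac{2^{w/2}}{\Gamma\!\left(\frac{1-w}{2}\right)}\,D_E(\phi,w).$$ Then $\tilde D_E(\phi,w)$ extends to a holomorphic function on $\mathbb{C}$.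
   Context: Principal series (plane model): for $\tau\in\mathbb{C}$, $\varepsilon\in\{0,1\}$, $\pi_{\tau,\varepsilon}$ acts on smooth functions $f$ on $\mathbb{R}^2\setminus\{0\}$ with $f(\lambda x)=|\lambda|^{\tau-1}\mathrm{sgn}(\lambda)^{\varepsilon}f(x)$ by $\pi_{\tau,\varepsilon}(g)f(x)=f(g^{-1}x)|\det g|^{\frac{\tau-1}{2}}\mathrm{sgn}(\det g)^\varepsilon$ ($x$ a column vector); the paper treats the even case $\varepsilon=0$ and writes $\pi_\tau$. The circle model is restriction to the unit circle $\{(\cos\theta,\sin\theta)\}$, identifying the representation space with smooth even functions on $S^1$ with the $L^2(S^1)$ inner product (normalized measure); $K$ acts by rotations and $e_n$ spans the $K$-type $n$. $e\in\Gamma\backslash G$ is the class of the identity. $\Gamma(\cdot)$ in the prefactor is the Gamma function. *)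

theory Defs
  imports "HOL-Analysis.Analysis"
begin

section \<open>Smooth functions and the topology of \<open>C\<^sup>\<infinity>(S)\<close>\<close>

fun iter_deriv :: "'a list \<Rightarrow> ('a::real_normed_vector \<Rightarrow> 'b::real_normed_vector) \<Rightarrow> 'a \<Rightarrow> 'b" where
  "iter_deriv [] f = f"
| "iter_deriv (v # vs) f = (\<lambda>x. frechet_derivative (iter_deriv vs f) (at x) v)"

text \<open>The next two notions are meant for open \<open>S\<close>.\<close>

definition Cinf_on :: "'a::real_normed_vector set \<Rightarrow> ('a \<Rightarrow> 'b::real_normed_vector) \<Rightarrow> bool" where
  "Cinf_on S f \<longleftrightarrow> (\<forall>vs. \<forall>x\<in>S. iter_deriv vs f differentiable (at x))"

text \<open>Convergence in the Frechet space \<open>C\<^sup>\<infinity>(S)\<close>: locally uniform convergence of all derivatives.\<close>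

definition Cinf_converges :: "'a::real_normed_vector set \<Rightarrow> (nat \<Rightarrow> 'a \<Rightarrow> 'b::real_normed_vector)
    \<Rightarrow> ('a \<Rightarrow> 'b) \<Rightarrow> bool" where
  "Cinf_converges S F f \<longleftrightarrow>
     (\<forall>vs C. compact C \<and> C \<subseteq> S \<longrightarrow>
        uniform_limit C (\<lambda>j. iter_deriv vs (F j)) (iter_deriv vs f) sequentially)"


section \<open>Functions on \<open>\<Gamma>\<setminus>G\<close>\<close>

text \<open>
  \<open>G = PGL\<^sub>2(\<real>)\<close> is the quotient of \<open>GL\<^sub>2(\<real>)\<close> by the scalar matrices. A function on \<open>\<Gamma>\<setminus>G\<close> with
  \<open>\<Gamma> = PGL\<^sub>2(\<int>)\<close> is rendered as a function of \<open>2 \<times> 2\<close> matrices which on \<open>GL\<^sub>2(\<real>)\<close> is invariant under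
  scalars and under left translation by \<open>GL\<^sub>2(\<int>)\<close>. It is set to 0 on the singular matrices, so that
  equality of functions on \<open>\<Gamma>\<setminus>G\<close> is equality in HOL.
\<close>

definition mat2 :: "real \<Rightarrow> real \<Rightarrow> real \<Rightarrow> real \<Rightarrow> real^2^2" where
  "mat2 a b c d = vector [vector [a, b], vector [c, d]]"

definition GL2R :: "(real^2^2) set" where
  "GL2R = {g. invertible g}"

definition GL2Z :: "(real^2^2) set" where
  "GL2Z = {g. (\<forall>i j. g $ i $ j \<in> \<int>) \<and> \<bar>det g\<bar> = 1}"

definition Cinf_Gamma_G :: "(real^2^2 \<Rightarrow> complex) set" where
  "Cinf_Gamma_G = {F. Cinf_on GL2R F
      \<and> (\<forall>g\<in>GL2R. \<forall>z. z \<noteq> 0 \<longrightarrow> F (z *\<^sub>R g) = F g)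
      \<and> (\<forall>g\<in>GL2R. \<forall>\<gamma>\<in>GL2Z. F (\<gamma> ** g) = F g)
      \<and> (\<forall>g. g \<notin> GL2R \<longrightarrow> F g = 0)}"


section \<open>Hecke--Maass cusp forms\<close>

definition right_K_invariant :: "(real^2^2 \<Rightarrow> complex) \<Rightarrow> bool" where
  "right_K_invariant \<phi> \<longleftrightarrow>
     (\<forall>g\<in>GL2R. \<forall>\<theta>. \<phi> (g ** mat2 (cos \<theta>) (- sin \<theta>) (sin \<theta>) (cos \<theta>)) = \<phi> g)"

definition cuspidal :: "(real^2^2 \<Rightarrow> complex) \<Rightarrow> bool" where
  "cuspidal \<phi> \<longleftrightarrow> (\<forall>g\<in>GL2R. integral {0..1} (\<lambda>t. \<phi> (mat2 1 t 0 1 ** g)) = 0)"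

text \<open>
  \<open>G/K\<close> is the union of the upper and lower half planes: \<open>(x, y)\<close> with \<open>y \<noteq> 0\<close> stands for the coset of
  \<open>mat2 y x 0 1\<close>, which moves \<open>\<i>\<close> to \<open>x + \<i> y\<close>.
\<close>

definition on_half_planes :: "(real^2^2 \<Rightarrow> complex) \<Rightarrow> real \<times> real \<Rightarrow> complex" where
  "on_half_planes \<phi> = (\<lambda>(x, y). \<phi> (mat2 y x 0 1))"

definition Laplace_Beltrami :: "(real \<times> real \<Rightarrow> complex) \<Rightarrow> real \<times> real \<Rightarrow> complex" where
  "Laplace_Beltrami f = (\<lambda>(x, y). - of_real (y\<^sup>2) *
      (iter_deriv [(1, 0), (1, 0)] f (x, y) + iter_deriv [(0, 1), (0, 1)] f (x, y)))"

definition Laplace_eigenfunction :: "(real^2^2 \<Rightarrow> complex) \<Rightarrow> bool" where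
  "Laplace_eigenfunction \<phi> \<longleftrightarrow>
     (\<exists>\<mu>. \<forall>x y. y \<noteq> 0 \<longrightarrow>
        Laplace_Beltrami (on_half_planes \<phi>) (x, y) = \<mu> * on_half_planes \<phi> (x, y))"

text \<open>
  The matrices \<open>mat2 (n/d) b 0 d\<close> with \<open>d dvd n\<close> and \<open>0 \<le> b < d\<close> represent the orbits of \<open>GL\<^sub>2(\<int>)\<close>, acting
  from the left, on the integral matrices of determinant \<open>\<plusminus>n\<close>.
\<close>

definition Hecke :: "nat \<Rightarrow> (real^2^2 \<Rightarrow> complex) \<Rightarrow> real^2^2 \<Rightarrow> complex" where
  "Hecke n \<phi> g = (\<Sum>d | d dvd n. \<Sum>b<d. \<phi> (mat2 (real (n div d)) (real b) 0 (real d) ** g))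
                   / of_real (sqrt (real n))"

definition Hecke_eigenfunction :: "(real^2^2 \<Rightarrow> complex) \<Rightarrow> bool" where
  "Hecke_eigenfunction \<phi> \<longleftrightarrow> (\<forall>n\<ge>1. \<exists>\<mu>. \<forall>g\<in>GL2R. Hecke n \<phi> g = \<mu> * \<phi> g)"

definition Hecke_Maass_cusp_form :: "(real^2^2 \<Rightarrow> complex) \<Rightarrow> bool" where
  "Hecke_Maass_cusp_form \<phi> \<longleftrightarrow> \<phi> \<in> Cinf_Gamma_G \<and> right_K_invariant \<phi> \<and> cuspidal \<phi>
     \<and> Laplace_eigenfunction \<phi> \<and> Hecke_eigenfunction \<phi>"

text \<open>
  Since \<open>mat2 (-1) 0 0 1 \<in> GL2Z\<close> exchanges the half planes, \<open>\<Gamma>\<setminus>G/K\<close> is the modular surface, with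
  the following fundamental domain. The invariant measure on \<open>\<Gamma>\<setminus>G\<close> is unique up to a constant
  factor, which is kept as the parameter \<open>c > 0\<close>.
\<close>

definition fundamental_domain :: "(real \<times> real) set" where
  "fundamental_domain = {(x, y). \<bar>x\<bar> \<le> 1/2 \<and> x\<^sup>2 + y\<^sup>2 \<ge> 1 \<and> y > 0}"

definition L2_norm_Gamma_G :: "real \<Rightarrow> (real^2^2 \<Rightarrow> complex) \<Rightarrow> real" where
  "L2_norm_Gamma_G c \<phi> =
     sqrt (c * (LINT p:fundamental_domain|lborel. (norm (on_half_planes \<phi> p))\<^sup>2 / (snd p)\<^sup>2))"


section \<open>The principal series \<open>\<pi>\<^sub>\<tau>\<close>\<close>

text \<open>As above, the value at the irrelevant point 0 is fixed to be 0.\<close>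

definition PS_space :: "complex \<Rightarrow> (real^2 \<Rightarrow> complex) set" where
  "PS_space \<tau> = {f. Cinf_on (- {0}) f
      \<and> (\<forall>x t. x \<noteq> 0 \<and> t \<noteq> 0 \<longrightarrow> f (t *\<^sub>R x) = of_real \<bar>t\<bar> powr (\<tau> - 1) * f x)
      \<and> f 0 = 0}"

definition PS_action :: "complex \<Rightarrow> real^2^2 \<Rightarrow> (real^2 \<Rightarrow> complex) \<Rightarrow> real^2 \<Rightarrow> complex" where
  "PS_action \<tau> g f = (\<lambda>x. f (matrix_inv g *v x) * of_real \<bar>det g\<bar> powr ((\<tau> - 1) / 2))"

text \<open>
  The circle model is restriction to the unit circle; for even \<open>n\<close>, the function below is the
  element of \<open>PS_space \<tau>\<close> that restricts to \<open>e\<^sub>n(\<theta>) = exp (\<i> n \<theta>)\<close>.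
\<close>

definition PS_basis :: "complex \<Rightarrow> int \<Rightarrow> real^2 \<Rightarrow> complex" where
  "PS_basis \<tau> n x = (if x = 0 then 0
     else of_real (norm x) powr (\<tau> - 1) * cis (of_int n * Arg (Complex (x $ 1) (x $ 2))))"

lemma PS_basis_circle: "PS_basis \<tau> n (vector [cos \<theta>, sin \<theta>]) = exp (\<i> * of_int n * of_real \<theta>)"
proof -
  have eq: "Complex (cos \<theta>) (sin \<theta>) = cis \<theta>"
    by (simp add: complex_eq_iff)
  have nrm: "norm (vector [cos \<theta>, sin \<theta>] :: real^2) = 1"
    by (simp add: norm_vec_def L2_set_def UNIV_2)
  obtain k :: int where k: "Arg (cis \<theta>) = \<theta> + of_int k * (2 * pi)"
  proof -
    have "cis (Arg (cis \<theta>)) = cis \<theta>"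
      by (simp add: cis_Arg sgn_div_norm)
    then have "exp (\<i> * of_real (Arg (cis \<theta>))) = exp (\<i> * of_real \<theta>)"
      by (simp add: cis_conv_exp)
    then obtain k :: int where "\<i> * of_real (Arg (cis \<theta>)) = \<i> * of_real \<theta> + of_int (2 * k) * pi * \<i>"
      by (auto simp: exp_eq)
    from arg_cong[OF this, of Im] have "Arg (cis \<theta>) = \<theta> + of_int k * (2 * pi)"
      by simp
    then show ?thesis by (rule that)
  qed
  have "cis (of_int n * Arg (cis \<theta>)) = cis (of_int n * \<theta>) * cis (2 * pi * of_int (n * k))"
    unfolding k cis_mult by (simp add: algebra_simps)
  also have "cis (2 * pi * of_int (n * k)) = 1"
    by (intro cis_multiple_2pi) simp
  finally show ?thesis
    using nrm by (auto simp: PS_basis_def eq cis_conv_exp mult_ac)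
qed

text \<open>
  Embeddings are continuous. The topologies are metrizable, so this is sequential continuity; the
  topology which \<open>PS_space \<tau>\<close> inherits from \<open>C\<^sup>\<infinity>(\<real>\<^sup>2 - {0})\<close> is, by homogeneity, that of \<open>C\<^sup>\<infinity>\<close> of the
  circle.
\<close>

definition PS_embedding :: "complex \<Rightarrow> ((real^2 \<Rightarrow> complex) \<Rightarrow> real^2^2 \<Rightarrow> complex) \<Rightarrow> bool" where
  "PS_embedding \<tau> \<nu> \<longleftrightarrow>
     \<nu> ` PS_space \<tau> \<subseteq> Cinf_Gamma_G
     \<and> inj_on \<nu> (PS_space \<tau>)
     \<and> (\<forall>f\<in>PS_space \<tau>. \<forall>h\<in>PS_space \<tau>. \<nu> (\<lambda>x. f x + h x) = (\<lambda>g. \<nu> f g + \<nu> h g))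
     \<and> (\<forall>f\<in>PS_space \<tau>. \<forall>z. \<nu> (\<lambda>x. z * f x) = (\<lambda>g. z * \<nu> f g))
     \<and> (\<forall>F f. (\<forall>j. F j \<in> PS_space \<tau>) \<and> f \<in> PS_space \<tau> \<and> Cinf_converges (- {0}) F f \<longrightarrow>
           Cinf_converges GL2R (\<lambda>j. \<nu> (F j)) (\<nu> f))
     \<and> (\<forall>f\<in>PS_space \<tau>. \<forall>g\<in>GL2R. \<forall>h\<in>GL2R. \<nu> (PS_action \<tau> g f) h = \<nu> f (h ** g))"

text \<open>The closed subspace of \<open>C\<^sup>\<infinity>(\<Gamma>\<setminus>G)\<close> spanned by the right translates of \<open>\<phi>\<close>.\<close>

definition generated_rep :: "(real^2^2 \<Rightarrow> complex) \<Rightarrow> (real^2^2 \<Rightarrow> complex) set" where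
  "generated_rep \<phi> = {F \<in> Cinf_Gamma_G. \<exists>P.
      (\<forall>j. \<exists>S c. finite S \<and> S \<subseteq> GL2R \<and> P j = (\<lambda>h. \<Sum>g\<in>S. c g * \<phi> (h ** g)))
      \<and> Cinf_converges GL2R P F}"


section \<open>The Dirichlet series\<close>

definition PS_coeff :: "complex \<Rightarrow> ((real^2 \<Rightarrow> complex) \<Rightarrow> real^2^2 \<Rightarrow> complex) \<Rightarrow> int \<Rightarrow> complex" where
  "PS_coeff \<tau> \<nu> n = \<nu> (PS_basis \<tau> n) (mat 1)"

definition D_E_term :: "(int \<Rightarrow> complex) \<Rightarrow> complex \<Rightarrow> int \<Rightarrow> complex" where
  "D_E_term a w n = a n * of_int \<bar>n\<bar> powr (- w)"

definition D_E :: "(int \<Rightarrow> complex) \<Rightarrow> complex \<Rightarrow> complex" where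
  "D_E a w = a 0 + (\<Sum>\<^sub>\<infinity>n\<in>{n. even n \<and> n \<noteq> 0}. D_E_term a w n)"

text \<open>\<open>rGamma\<close> is the reciprocal of the Gamma function, with its zeros at the poles of \<open>Gamma\<close>.\<close>

definition D_E_tilde :: "(int \<Rightarrow> complex) \<Rightarrow> complex \<Rightarrow> complex" where
  "D_E_tilde a w = 2 powr (w / 2) * rGamma ((1 - w) / 2) * D_E a w"

end

theory Submission
  imports Defs "HOL-Complex_Analysis.Complex_Analysis"
begin

text \<open>
  Already \<open>D\<^sub>E(\<phi>, w)\<close> is entire. Put
  \<open>A\<^sub>m(t) = \<nu>(e\<^sub>2\<^sub>m)(n(t))\<close> with \<open>n(t)\<close> the upper unipotent matrices. Continuity of \<open>\<nu>\<close> makes these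
  functions grow polynomially in \<open>m\<close>, of some order \<open>M\<close>, uniformly for \<open>t\<close> in \<open>[0, 1]\<close>. They satisfy
  \<open>A' = T A\<close>, where the tridiagonal operator \<open>T\<close> describes the infinitesimal action of \<open>n(t)\<close> on the
  \<open>K\<close>-types, and by cuspidality they have mean zero on \<open>[0, 1]\<close>. Hence the mean-zero primitive \<open>B\<close> of \<open>A\<close>
  satisfies \<open>T B = A\<close> with the same order of growth \<open>M\<close>, and so on: \<open>A = T\<^sup>k B\<^sub>k\<close> for every \<open>k\<close>.
  The transpose of \<open>T\<close> involves only differences and improves the decay of \<open>|m|\<^sup>-\<^sup>w\<close> by a factor \<open>1/|m|\<close>,
  because the vector field of \<open>n(t)\<close> on the circle vanishes to second order at the singularity of the
  distribution \<open>\<Sum> |n|\<^sup>-\<^sup>w e\<^sub>n\<close>. Summing by parts \<open>k\<close> times thus moves the half-plane of absolute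
  convergence \<open>k\<close> units to the left.
\<close>

section \<open>Symbols\<close>

fun fdiff :: "nat \<Rightarrow> (int \<Rightarrow> complex) \<Rightarrow> int \<Rightarrow> complex" where
  "fdiff 0 u m = u m"
| "fdiff (Suc j) u m = fdiff j u (m + 1) - fdiff j u m"

text \<open>Discrete analogue of a holomorphic family of classical symbols of order
  \<open>- Re w - d\<close>: each difference gains one power of decay, and \<open>d\<close> counts
  the gain over \<open>|m|^-w\<close>. The constant may depend on \<open>R\<close> and
  \<open>j\<close> but not on \<open>w\<close> in the disc, which later makes sums over
  \<open>m\<close> converge locally uniformly in \<open>w\<close>.\<close>

definition int_symbol :: "real \<Rightarrow> (complex \<Rightarrow> int \<Rightarrow> complex) \<Rightarrow> bool" where
  "int_symbol d u \<longleftrightarrow> (\<forall>m. (\<lambda>w. u w m) holomorphic_on UNIV) \<and>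
     (\<forall>R j. \<exists>C. \<forall>w m. norm w \<le> R \<longrightarrow>
        norm (fdiff j (u w) m) \<le> C * (1 + real_of_int \<bar>m\<bar>) powr (- Re w - d - real j))"

lemma int_symbolI:
  assumes "\<And>m. (\<lambda>w. u w m) holomorphic_on UNIV"
    and "\<And>R j. \<exists>C. \<forall>w m. norm w \<le> R \<longrightarrow>
        norm (fdiff j (u w) m) \<le> C * (1 + real_of_int \<bar>m\<bar>) powr (- Re w - d - real j)"
  shows "int_symbol d u"
  using assms by (auto simp: int_symbol_def)

lemma int_symbol_holo: "int_symbol d u \<Longrightarrow> (\<lambda>w. u w m) holomorphic_on UNIV"
  by (auto simp: int_symbol_def)

lemma int_symbolE:
  assumes "int_symbol d u"
  obtains C where "C \<ge> 0" "\<And>w m. norm w \<le> R \<Longrightarrow>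
        norm (fdiff j (u w) m) \<le> C * (1 + real_of_int \<bar>m\<bar>) powr (- Re w - d - real j)"
proof -
  obtain C where C: "\<And>w m. norm w \<le> R \<Longrightarrow>
        norm (fdiff j (u w) m) \<le> C * (1 + real_of_int \<bar>m\<bar>) powr (- Re w - d - real j)"
    using assms by (force simp: int_symbol_def)
  have "norm (fdiff j (u w) m) \<le> max C 0 * (1 + real_of_int \<bar>m\<bar>) powr (- Re w - d - real j)"
    if "norm w \<le> R" for w m
    using C[OF that, of m] mult_right_mono[of C "max C 0" "(1 + real_of_int \<bar>m\<bar>) powr (- Re w - d - real j)"]
    by simp
  then show ?thesis by (intro that[of "max C 0"]) auto
qed

lemma fdiff_add: "fdiff j (\<lambda>m. u m + v m) m = fdiff j u m + fdiff j v m"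
  by (induction j arbitrary: m) auto

lemma fdiff_cmult: "fdiff j (\<lambda>m. c * u m) m = c * fdiff j u m"
  by (induction j arbitrary: m) (auto simp: algebra_simps)

lemma fdiff_shift: "fdiff j (\<lambda>m. u (m + k)) m = fdiff j u (m + k)"
  by (induction j arbitrary: m) (auto simp: algebra_simps)

lemma fdiff_fdiff1: "fdiff j (\<lambda>m. u (m + 1) - u m) m = fdiff (Suc j) u m"
  by (induction j arbitrary: m) auto

text \<open>Reflection turns forward differences into backward ones, hence the base point
  \<open>- m - int j\<close>. It carries estimates for an even symbol from positive to negative
  indices.\<close>

lemma fdiff_uminus: "fdiff j (\<lambda>m. u (- m)) m = (-1) ^ j * fdiff j u (- m - int j)"
  by (induction j arbitrary: m) (auto simp: algebra_simps)

text \<open>Discrete Leibniz rule; only two terms appear because second differences of the factor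
  \<open>m\<close> vanish. For \<open>j = 0\<close> the truncated \<open>j - 1\<close> is harmless
  thanks to the factor \<open>of_nat j\<close>.\<close>

lemma fdiff_times_index:
  "fdiff j (\<lambda>m. of_int m * u m) m = of_int m * fdiff j u m + of_nat j * fdiff (j - 1) u (m + 1)"
proof (induction j arbitrary: m)
  case (Suc j)
  show ?case
    unfolding fdiff.simps Suc.IH by (cases j) (simp_all add: algebra_simps)
qed auto

lemma int_symbol_add:
  assumes "int_symbol d u" "int_symbol d v"
  shows "int_symbol d (\<lambda>w m. u w m + v w m)"
proof (intro int_symbolI)
  show "(\<lambda>w. u w m + v w m) holomorphic_on UNIV" for m
    by (intro holomorphic_intros int_symbol_holo[OF assms(1)] int_symbol_holo[OF assms(2)])
  fix R j
  obtain C where C: "\<And>w m. norm w \<le> R \<Longrightarrow>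
        norm (fdiff j (u w) m) \<le> C * (1 + real_of_int \<bar>m\<bar>) powr (- Re w - d - real j)"
    using int_symbolE[OF assms(1)] by metis
  obtain D where D: "\<And>w m. norm w \<le> R \<Longrightarrow>
        norm (fdiff j (v w) m) \<le> D * (1 + real_of_int \<bar>m\<bar>) powr (- Re w - d - real j)"
    using int_symbolE[OF assms(2)] by metis
  show "\<exists>C. \<forall>w m. norm w \<le> R \<longrightarrow>
        norm (fdiff j (\<lambda>m. u w m + v w m) m) \<le> C * (1 + real_of_int \<bar>m\<bar>) powr (- Re w - d - real j)"
    by (intro exI[of _ "C + D"] allI impI)
      (auto simp: fdiff_add distrib_right simp del: of_int_abs intro!: norm_triangle_mono C D)
qed

lemma int_symbol_cmult:
  assumes "int_symbol d u"
  shows "int_symbol d (\<lambda>w m. c * u w m)"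
proof (intro int_symbolI)
  show "(\<lambda>w. c * u w m) holomorphic_on UNIV" for m
    by (intro holomorphic_intros int_symbol_holo[OF assms(1)])
  fix R j
  obtain C where C: "\<And>w m. norm w \<le> R \<Longrightarrow>
        norm (fdiff j (u w) m) \<le> C * (1 + real_of_int \<bar>m\<bar>) powr (- Re w - d - real j)"
    using int_symbolE[OF assms(1)] by metis
  show "\<exists>C. \<forall>w m. norm w \<le> R \<longrightarrow>
        norm (fdiff j (\<lambda>m. c * u w m) m) \<le> C * (1 + real_of_int \<bar>m\<bar>) powr (- Re w - d - real j)"
    by (intro exI[of _ "norm c * C"] allI impI)
      (auto simp: fdiff_cmult norm_mult mult.assoc simp del: of_int_abs intro!: mult_left_mono C)
qed

text \<open>\<open>1 + |m + k|\<close> and \<open>1 + |m|\<close> differ by a factor of at most 2.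
  The bound \<open>L\<close> stands in for \<open>|e|\<close> so that one constant serves all
  exponents \<open>- Re w - d - j\<close> with \<open>w\<close> in a disc.\<close>

lemma abs_shift_powr_le:
  fixes m k :: int and e :: real
  assumes "\<bar>k\<bar> \<le> 1" "\<bar>e\<bar> \<le> L"
  shows "(1 + real_of_int \<bar>m + k\<bar>) powr e \<le> 2 powr L * (1 + real_of_int \<bar>m\<bar>) powr e"
proof -
  define x where "x = 1 + real_of_int \<bar>m + k\<bar>"
  define y where "y = 1 + real_of_int \<bar>m\<bar>"
  have "\<bar>m + k\<bar> \<le> \<bar>m\<bar> + 1" "\<bar>m\<bar> \<le> \<bar>m + k\<bar> + 1"
    using assms(1) by linarith+
  then have "real_of_int \<bar>m + k\<bar> \<le> real_of_int \<bar>m\<bar> + 1" "real_of_int \<bar>m\<bar> \<le> real_of_int \<bar>m + k\<bar> + 1"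
    by linarith+
  then have "x \<le> y + 1" "y \<le> x + 1" unfolding x_def y_def by linarith+
  moreover have "x \<ge> 1" "y \<ge> 1" by (simp_all add: x_def y_def)
  ultimately have xy: "x > 0" "y > 0" "x \<le> 2 * y" "y \<le> 2 * x" by linarith+
  have "(x / y) powr e \<le> 2 powr \<bar>e\<bar>"
  proof (cases "e \<ge> 0")
    case True
    then show ?thesis using xy by (auto intro!: powr_mono2 simp: field_simps)
  next
    case False
    have "(x / y) powr e = (y / x) powr (- e)"
      using xy by (simp add: powr_divide powr_minus field_simps)
    also have "\<dots> \<le> 2 powr (- e)"
      using xy False by (intro powr_mono2) (auto simp: field_simps)
    finally show ?thesis using False by simp
  qed
  also have "\<dots> \<le> 2 powr L" using assms by (intro powr_mono) auto
  finally show ?thesis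
    unfolding x_def[symmetric] y_def[symmetric] using xy by (simp add: powr_divide field_simps)
qed

lemma int_symbol_shift:
  assumes "int_symbol d u" "\<bar>k\<bar> \<le> 1"
  shows "int_symbol d (\<lambda>w m. u w (m + k))"
proof (intro int_symbolI)
  show "(\<lambda>w. u w (m + k)) holomorphic_on UNIV" for m
    by (intro int_symbol_holo[OF assms(1)])
  fix R j
  obtain C where C: "C \<ge> 0" "\<And>w m. norm w \<le> R \<Longrightarrow>
        norm (fdiff j (u w) m) \<le> C * (1 + real_of_int \<bar>m\<bar>) powr (- Re w - d - real j)"
    using int_symbolE[OF assms(1)] by metis
  show "\<exists>C. \<forall>w m. norm w \<le> R \<longrightarrow>
        norm (fdiff j (\<lambda>m. u w (m + k)) m) \<le> C * (1 + real_of_int \<bar>m\<bar>) powr (- Re w - d - real j)"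
  proof (intro exI[of _ "C * 2 powr (R + \<bar>d\<bar> + real j)"] allI impI)
    fix w :: complex and m :: int
    assume w: "norm w \<le> R"
    then have "\<bar>- Re w - d - real j\<bar> \<le> R + \<bar>d\<bar> + real j"
      using abs_Re_le_cmod[of w] by linarith
    then have "(1 + real_of_int \<bar>m + k\<bar>) powr (- Re w - d - real j)
        \<le> 2 powr (R + \<bar>d\<bar> + real j) * (1 + real_of_int \<bar>m\<bar>) powr (- Re w - d - real j)"
      using assms(2) by (rule abs_shift_powr_le[rotated])
    from mult_left_mono[OF this C(1)] C(2)[OF w, of "m + k"]
    show "norm (fdiff j (\<lambda>m. u w (m + k)) m)
        \<le> C * 2 powr (R + \<bar>d\<bar> + real j) * (1 + real_of_int \<bar>m\<bar>) powr (- Re w - d - real j)"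
      by (simp add: fdiff_shift mult.assoc)
  qed
qed

lemma int_symbol_fdiff:
  assumes "int_symbol d u"
  shows "int_symbol (d + 1) (\<lambda>w m. u w (m + 1) - u w m)"
proof (intro int_symbolI)
  show "(\<lambda>w. u w (m + 1) - u w m) holomorphic_on UNIV" for m
    by (intro holomorphic_intros int_symbol_holo[OF assms(1)])
  fix R j
  obtain C where C: "\<And>w m. norm w \<le> R \<Longrightarrow>
        norm (fdiff (Suc j) (u w) m) \<le> C * (1 + real_of_int \<bar>m\<bar>) powr (- Re w - d - real (Suc j))"
    using int_symbolE[OF assms(1)] by metis
  show "\<exists>C. \<forall>w m. norm w \<le> R \<longrightarrow>
        norm (fdiff j (\<lambda>m. u w (m + 1) - u w m) m) \<le> C * (1 + real_of_int \<bar>m\<bar>) powr (- Re w - (d + 1) - real j)"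
    using C unfolding fdiff_fdiff1 by (intro exI[of _ C]) (simp add: algebra_simps)
qed

text \<open>In \<open>fdiff_times_index\<close> the first term loses one power through the factor
  \<open>m\<close>, the second because it has one difference fewer.\<close>

lemma int_symbol_times_index:
  assumes "int_symbol d u"
  shows "int_symbol (d - 1) (\<lambda>w m. of_int m * u w m)"
proof (intro int_symbolI)
  show "(\<lambda>w. of_int m * u w m) holomorphic_on UNIV" for m
    by (intro holomorphic_intros int_symbol_holo[OF assms(1)])
  fix R j
  obtain C where C: "C \<ge> 0" "\<And>w m. norm w \<le> R \<Longrightarrow>
        norm (fdiff j (u w) m) \<le> C * (1 + real_of_int \<bar>m\<bar>) powr (- Re w - d - real j)"
    using int_symbolE[OF assms(1)] by metis
  obtain D where D: "D \<ge> 0" "\<And>w m. norm w \<le> R \<Longrightarrow>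
        norm (fdiff (j - 1) (\<lambda>m. u w (m + 1)) m) \<le> D * (1 + real_of_int \<bar>m\<bar>) powr (- Re w - d - real (j - 1))"
    using int_symbolE[OF int_symbol_shift[OF assms(1), of 1]] by (metis abs_one order_refl)
  show "\<exists>C. \<forall>w m. norm w \<le> R \<longrightarrow>
        norm (fdiff j (\<lambda>m. of_int m * u w m) m) \<le> C * (1 + real_of_int \<bar>m\<bar>) powr (- Re w - (d - 1) - real j)"
  proof (intro exI[of _ "C + real j * D"] allI impI)
    fix w :: complex and m :: int
    assume w: "norm w \<le> R"
    define x where "x = 1 + real_of_int \<bar>m\<bar>"
    have x: "x > 0" by (simp add: x_def)
    have e: "x powr (- Re w - (d - 1) - real j) = x * x powr (- Re w - d - real j)"
      using x powr_add[of x 1 "- Re w - d - real j"] by (simp add: algebra_simps)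
    have 1: "norm (of_int m * fdiff j (u w) m) \<le> C * x powr (- Re w - (d - 1) - real j)"
    proof -
      have "norm (of_int m * fdiff j (u w) m) \<le> x * (C * x powr (- Re w - d - real j))"
        unfolding norm_mult using C(2)[OF w, of m] x
        by (intro mult_mono) (auto simp: x_def)
      then show ?thesis by (simp add: e mult_ac)
    qed
    have 2: "norm (of_nat j * fdiff (j - 1) (u w) (m + 1)) \<le> real j * D * x powr (- Re w - (d - 1) - real j)"
    proof (cases j)
      case (Suc i)
      have "norm (fdiff (j - 1) (u w) (m + 1)) \<le> D * x powr (- Re w - (d - 1) - real j)"
      proof -
        have "- Re w - (d - 1) - real j = - Re w - d - real (j - 1)" using Suc by simp
        then show ?thesis using D(2)[OF w, of m] by (simp only: fdiff_shift x_def)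
      qed
      then show ?thesis
        unfolding norm_mult norm_of_nat mult.assoc by (rule mult_left_mono) simp
    qed auto
    show "norm (fdiff j (\<lambda>m. of_int m * u w m) m)
        \<le> (C + real j * D) * (1 + real_of_int \<bar>m\<bar>) powr (- Re w - (d - 1) - real j)"
      unfolding fdiff_times_index distrib_right using norm_triangle_mono[OF 1 2] by (simp add: x_def)
  qed
qed

section \<open>The symbol \<open>|m|\<^sup>-\<^sup>w\<close>\<close>

fun real_fdiff :: "nat \<Rightarrow> (real \<Rightarrow> complex) \<Rightarrow> real \<Rightarrow> complex" where
  "real_fdiff 0 f x = f x"
| "real_fdiff (Suc j) f x = real_fdiff j f (x + 1) - real_fdiff j f x"

lemma real_fdiff_cmult: "real_fdiff j (\<lambda>x. c * f x) x = c * real_fdiff j f x"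
  by (induction j arbitrary: x) (auto simp: algebra_simps)

lemma has_vector_derivative_real_fdiff:
  assumes "\<And>x. x > 0 \<Longrightarrow> (f has_vector_derivative f' x) (at x)" "x > 0"
  shows "(real_fdiff j f has_vector_derivative real_fdiff j f' x) (at x)"
  using assms(2)
proof (induction j arbitrary: x)
  case 0
  then show ?case using assms(1) by simp
next
  case (Suc j)
  have "((real_fdiff j f \<circ> (\<lambda>x. x + 1)) has_vector_derivative 1 *\<^sub>R real_fdiff j f' (x + 1)) (at x)"
    using Suc by (intro vector_diff_chain_at) (auto intro!: derivative_eq_intros simp: has_vector_derivative_def)
  from has_vector_derivative_diff[OF this Suc.IH[OF Suc.prems]]
  show ?case by (simp add: o_def)
qed

text \<open>Mean value inequality: the derivative of \<open>x^-w\<close> is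
  \<open>-w * x^-(w+1)\<close>, so one more difference is controlled by the \<open>j\<close>-th
  difference at parameter \<open>w + 1\<close>. This is why \<open>R\<close> varies in the induction
  and the hypothesis is taken at \<open>R + 1\<close>.\<close>

lemma real_fdiff_powr_bound:
  "\<exists>K\<ge>0. \<forall>w x. norm w \<le> R \<longrightarrow> x \<ge> 1 \<longrightarrow>
     norm (real_fdiff j (\<lambda>x. of_real x powr (- w)) x) \<le> K * x powr (- Re w - real j)"
proof (induction j arbitrary: R)
  case 0
  show ?case by (intro exI[of _ 1]) (auto simp: norm_powr_real_powr)
next
  case (Suc j)
  obtain K where K: "K \<ge> 0" "\<And>w x. norm w \<le> R + 1 \<Longrightarrow> x \<ge> 1 \<Longrightarrow>
     norm (real_fdiff j (\<lambda>x. of_real x powr (- w)) x) \<le> K * x powr (- Re w - real j)"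
    using Suc.IH[of "R + 1"] by blast
  define L where "L = R * (K * 2 powr (R + 1 + real j))"
  show ?case
  \<comment> \<open>For \<open>R < 0\<close> the estimate is vacuous but \<open>L\<close> may be
    negative; \<open>max\<close> secures the sign.\<close>
  proof (intro exI[of _ "max L 0"] conjI allI impI)
    fix w :: complex and x :: real
    assume w: "norm w \<le> R" and x: "x \<ge> 1"
    have R: "R \<ge> 0" using w norm_ge_zero order_trans by blast
    have L: "L \<ge> 0" using K R by (simp add: L_def)
    let ?f = "\<lambda>w x. of_real x powr (- w) :: complex"
    have der: "(?f w has_vector_derivative - w * ?f (w + 1) y) (at y)" if "y > 0" for y
    proof -
      have "((\<lambda>z. z powr (- w)) has_field_derivative - w * of_real y powr (- w - 1)) (at (of_real y))"
        using that by (intro has_field_derivative_powr) (auto simp: complex_nonpos_Reals_iff)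
      then have "(?f w has_vector_derivative - w * of_real y powr (- w - 1)) (at y)"
        by (rule has_vector_derivative_real_field)
      moreover have "- w - 1 = - (w + 1)" by simp
      ultimately show ?thesis by (simp only:)
    qed
    have d: "(real_fdiff j (?f w) has_vector_derivative - w * real_fdiff j (?f (w + 1)) y) (at y)" if "y > 0" for y
      using has_vector_derivative_real_fdiff[OF der that, of j] by (simp only: real_fdiff_cmult)
    have bound: "norm (- w * real_fdiff j (?f (w + 1)) y) \<le> L * x powr (- Re w - real (Suc j))"
      if "y \<in> {x..x+1}" for y
    proof -
      have y: "y \<ge> 1" "y \<le> 2 * x" "x \<le> y" using that x by auto
      have e: "\<bar>- Re w - 1 - real j\<bar> \<le> R + 1 + real j" using w abs_Re_le_cmod[of w] by linarith
      have "(y / x) powr (- Re w - 1 - real j) \<le> (y / x) powr (R + 1 + real j)"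
        using y x e by (intro powr_mono) auto
      also have "\<dots> \<le> 2 powr (R + 1 + real j)"
        using y x e by (intro powr_mono2) (auto simp: field_simps)
      finally have yx: "y powr (- Re w - 1 - real j) \<le> 2 powr (R + 1 + real j) * x powr (- Re w - 1 - real j)"
        using x y by (simp add: powr_divide field_simps)
      have "norm (w + 1) \<le> R + 1" using w norm_triangle_ineq[of w 1] by simp
      moreover have "- Re (w + 1) - real j = - Re w - 1 - real j" by simp
      ultimately have "norm (real_fdiff j (?f (w + 1)) y) \<le> K * y powr (- Re w - 1 - real j)"
        using K(2)[of "w + 1" y] y(1) by (simp only:)
      also have "\<dots> \<le> K * (2 powr (R + 1 + real j) * x powr (- Re w - 1 - real j))"
        using yx K(1) by (rule mult_left_mono)
      finally have "norm w * norm (real_fdiff j (?f (w + 1)) y)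
          \<le> R * (K * (2 powr (R + 1 + real j) * x powr (- Re w - 1 - real j)))"
        using w R by (intro mult_mono) auto
      then show ?thesis by (simp add: norm_mult L_def mult.assoc algebra_simps)
    qed
    have "norm (real_fdiff j (?f w) (x + 1) - real_fdiff j (?f w) x)
        \<le> L * x powr (- Re w - real (Suc j)) * norm (x + 1 - x)"
    proof (rule differentiable_bound)
      show "(real_fdiff j (?f w) has_derivative (\<lambda>h. h *\<^sub>R (- w * real_fdiff j (?f (w + 1)) y)))
          (at y within {x..x + 1})" if "y \<in> {x..x+1}" for y
        using d[of y] that x unfolding has_vector_derivative_def
        by (auto intro: has_derivative_at_withinI)
      show "onorm (\<lambda>h. h *\<^sub>R (- w * real_fdiff j (?f (w + 1)) y)) \<le> L * x powr (- Re w - real (Suc j))"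
        if "y \<in> {x..x+1}" for y
        using bound[OF that] by (intro onorm_le) (simp add: mult_left_mono mult.commute)
    qed auto
    then show "norm (real_fdiff (Suc j) (?f w) x) \<le> max L 0 * x powr (- Re w - real (Suc j))"
      using L by simp
  qed auto
qed

text \<open>The index \<open>m\<close> stands for the \<open>K\<close>-type
  \<open>n = 2 * m\<close>. The value 1 at \<open>m = 0\<close> absorbs the separate term
  \<open>a 0\<close>, so that \<open>D_E\<close> becomes one sum over all integers.\<close>

definition abs_powr_symbol :: "complex \<Rightarrow> int \<Rightarrow> complex" where
  "abs_powr_symbol w m = (if m = 0 then 1 else of_int \<bar>2 * m\<bar> powr (- w))"

lemma abs_powr_symbol_holo: "(\<lambda>w. fdiff j (abs_powr_symbol w) m) holomorphic_on UNIV"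
proof (induction j arbitrary: m)
  case 0
  have "(\<lambda>w. abs_powr_symbol w m) = (\<lambda>w. if m = 0 then 1 else of_int \<bar>2 * m\<bar> powr (- w))"
    by (simp add: fun_eq_iff abs_powr_symbol_def)
  then show ?case by (cases "m = 0") (auto intro!: holomorphic_intros)
next
  case (Suc j)
  then show ?case by (auto intro!: holomorphic_intros)
qed

lemma fdiff_abs_powr_symbol_pos:
  assumes "m \<ge> 1"
  shows "fdiff j (abs_powr_symbol w) m
    = 2 powr (- w) * real_fdiff j (\<lambda>x. of_real x powr (- w)) (real_of_int m)"
  using assms
proof (induction j arbitrary: m)
  case 0
  then have "(2 * of_int m :: complex) powr (- w) = 2 powr (- w) * of_int m powr (- w)"
    using powr_times_real[of 2 "of_int m" "- w"] by simp
  with 0 show ?case by (simp add: abs_powr_symbol_def)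
next
  case (Suc j)
  then show ?case by (simp add: algebra_simps)
qed

text \<open>The points \<open>m, ..., m + j\<close> entering the difference avoid 0 if
  \<open>m \<ge> 1\<close> or \<open>m < - int j\<close>; there the estimate for \<open>x^-w\<close>
  applies, directly or after reflection. The finitely many other \<open>m\<close> are handled by
  compactness of the disc in \<open>w\<close>.\<close>

lemma int_symbol_abs_powr: "int_symbol 0 abs_powr_symbol"
proof (intro int_symbolI)
  show "(\<lambda>w. abs_powr_symbol w m) holomorphic_on UNIV" for m
    using abs_powr_symbol_holo[of 0 m] by simp
  fix R :: real and j :: nat
  let ?u = abs_powr_symbol
  obtain K where K: "K \<ge> 0" "\<And>w x. norm w \<le> R \<Longrightarrow> x \<ge> 1 \<Longrightarrow>
     norm (real_fdiff j (\<lambda>x. of_real x powr (- w)) x) \<le> K * x powr (- Re w - real j)"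
    using real_fdiff_powr_bound by metis
  define c where "c = 2 + real j"
  define D where "D = 2 powr R * K * c powr (R + real j)"
  \<comment> \<open>Used with \<open>p = m\<close> and, after reflection, with
    \<open>p = - m - int j\<close>. The two inequalities on \<open>m\<close> say that
    \<open>(1 + |m|) / p\<close> lies between 1 and \<open>c = 2 + j\<close>.\<close>
  have far: "norm (fdiff j (?u w) p) \<le> D * (1 + real_of_int \<bar>m\<bar>) powr (- Re w - real j)"
    if w: "norm w \<le> R" and p: "p \<ge> 1" and m: "1 + \<bar>m\<bar> \<le> (2 + int j) * p" "p \<le> 1 + \<bar>m\<bar>" for w p m
  proof -
    have R: "R \<ge> 0" "\<bar>Re w\<bar> \<le> R" using w norm_ge_zero abs_Re_le_cmod order_trans by blast+
    define x where "x = 1 + real_of_int \<bar>m\<bar>"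
    have x: "x > 0" "real_of_int p \<le> x" "x \<le> c * real_of_int p"
      using p m(2) of_int_le_iff[of "1 + \<bar>m\<bar>" "(2 + int j) * p", where 'a = real] m(1)
      by (auto simp: x_def c_def)
    have "real_of_int p powr (- Re w - real j) \<le> c powr (R + real j) * x powr (- Re w - real j)"
    proof -
      have q: "x / p \<ge> 1" "x / p \<le> c" using x p by (auto simp: field_simps)
      have "(x / p) powr - (- Re w - real j) \<le> (x / p) powr (R + real j)"
        using R q by (intro powr_mono) auto
      also have "\<dots> \<le> c powr (R + real j)"
        using R q by (intro powr_mono2) auto
      finally show ?thesis using x p unfolding powr_minus by (simp add: powr_divide field_simps)
    qed
    moreover have "norm (fdiff j (?u w) p) \<le> 2 powr R * (K * real_of_int p powr (- Re w - real j))"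
      unfolding fdiff_abs_powr_symbol_pos[OF p] norm_mult
      using K R w p by (intro mult_mono K) (auto simp: norm_powr_real_powr)
    ultimately have "norm (fdiff j (?u w) p)
       \<le> 2 powr R * (K * (c powr (R + real j) * x powr (- Re w - real j)))"
      using K(1) by (smt (verit, best) mult_left_mono powr_ge_zero)
    then show ?thesis by (simp add: D_def x_def mult.assoc)
  qed
  \<comment> \<open>For a single \<open>m\<close>, divide by the nonvanishing weight and bound a
    continuous function of \<open>w\<close> on the closed disc.\<close>
  have "\<exists>B\<ge>0. \<forall>w. norm w \<le> R \<longrightarrow>
      norm (fdiff j (?u w) m) \<le> B * (1 + real_of_int \<bar>m\<bar>) powr (- Re w - real j)" for m
  proof -
    let ?g = "\<lambda>w. norm (fdiff j (?u w) m) * (1 + real_of_int \<bar>m\<bar>) powr (Re w + real j)"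
    have "continuous_on (cball 0 R) ?g"
      by (intro continuous_intros holomorphic_on_imp_continuous_on
          holomorphic_on_subset[OF abs_powr_symbol_holo]) auto
    from compact_continuous_image[OF this compact_cball]
    have "bounded (?g ` cball 0 R)" by (rule compact_imp_bounded)
    then obtain B where "\<forall>y\<in>?g ` cball 0 R. norm y \<le> B"
      unfolding bounded_iff by blast
    then have B: "\<And>w. norm w \<le> R \<Longrightarrow> ?g w \<le> B"
      by simp
    have "norm (fdiff j (?u w) m) \<le> max B 0 * (1 + real_of_int \<bar>m\<bar>) powr (- Re w - real j)"
      if "norm w \<le> R" for w
    proof -
      define P where "P = (1 + real_of_int \<bar>m\<bar>) powr (Re w + real j)"
      define Q where "Q = (1 + real_of_int \<bar>m\<bar>) powr (- Re w - real j)"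
      have PQ: "P * Q = 1" "Q \<ge> 0" unfolding P_def Q_def by (simp_all flip: powr_add)
      have "norm (fdiff j (?u w) m) = ?g w * Q" using PQ unfolding P_def[symmetric] by simp
      also have "\<dots> \<le> max B 0 * Q" using B[OF that] PQ by (intro mult_right_mono) auto
      finally show ?thesis by (simp only: Q_def)
    qed
    then show ?thesis by (intro exI[of _ "max B 0"]) auto
  qed
  then obtain B where B: "\<And>m. B m \<ge> 0" "\<And>w m. norm w \<le> R \<Longrightarrow>
      norm (fdiff j (?u w) m) \<le> B m * (1 + real_of_int \<bar>m\<bar>) powr (- Re w - real j)"
    by metis
  define E where "E = (\<Sum>m\<in>{- int j..0}. B m)"
  have D: "D \<ge> 0" using K by (simp add: D_def)
  have E: "E \<ge> 0" using B by (auto simp: E_def intro: sum_nonneg)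
  show "\<exists>C. \<forall>w m. norm w \<le> R \<longrightarrow>
        norm (fdiff j (?u w) m) \<le> C * (1 + real_of_int \<bar>m\<bar>) powr (- Re w - 0 - real j)"
  proof (intro exI[of _ "D + E"] allI impI)
    fix w :: complex and m :: int
    assume w: "norm w \<le> R"
    let ?x = "(1 + real_of_int \<bar>m\<bar>) powr (- Re w - real j)"
    consider "m \<ge> 1" | "m < - int j" | "m \<in> {- int j..0}" by fastforce
    then have "norm (fdiff j (?u w) m) \<le> D * ?x \<or> norm (fdiff j (?u w) m) \<le> E * ?x"
    proof cases
      case 1
      have "1 + \<bar>m\<bar> \<le> (2 + int j) * m"
        using 1 by (simp add: distrib_right add_increasing2)
      then show ?thesis using far[OF w, of m m] 1 by auto
    next
      case 2
      define p where "p = - m - int j"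
      have p: "p \<ge> 1" using 2 by (simp add: p_def)
      have "(\<lambda>m. ?u w (- m)) = ?u w" by (simp add: fun_eq_iff abs_powr_symbol_def)
      then have "norm (fdiff j (?u w) m) = norm (fdiff j (?u w) p)"
        using fdiff_uminus[of j "?u w" m] by (simp add: p_def norm_mult norm_power)
      moreover have "1 + \<bar>m\<bar> \<le> (2 + int j) * p"
        using p mult_right_mono[of 1 p "1 + int j"] by (simp add: p_def algebra_simps)
      ultimately show ?thesis using far[OF w, of p m] p 2 by (auto simp: p_def)
    next
      case 3
      then have "B m \<le> E" unfolding E_def using B(1) by (intro member_le_sum) auto
      then have "B m * ?x \<le> E * ?x" by (intro mult_right_mono) auto
      then show ?thesis using B(2)[OF w, of m] by linarith
    qed
    moreover have "D * ?x \<ge> 0" "E * ?x \<ge> 0" using D E by auto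
    ultimately show "norm (fdiff j (?u w) m) \<le> (D + E) * (1 + real_of_int \<bar>m\<bar>) powr (- Re w - 0 - real j)"
      unfolding distrib_right diff_0_right by linarith
  qed
qed

section \<open>The infinitesimal shear on sequences\<close>

text \<open>The operator \<open>T\<close> of the overview. The embedding leads to
  \<open>\<mu> = (\<tau> - 1) / 2\<close>; see \<open>PS_embedding_shear\<close>.\<close>

definition shear_op :: "complex \<Rightarrow> (int \<Rightarrow> complex) \<Rightarrow> int \<Rightarrow> complex" where
  "shear_op \<mu> b m = \<i> / 2 * (2 * of_int m * b m - (of_int m + \<mu>) * b (m - 1) - (of_int m - \<mu>) * b (m + 1))"

text \<open>Transpose of \<open>shear_op\<close> for the bilinear pairing of \<open>b\<close> and
  \<open>u\<close> by summing \<open>b m * u m\<close>: the off-diagonal coefficients are taken at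
  the neighbouring index.\<close>

definition shear_adj :: "complex \<Rightarrow> (int \<Rightarrow> complex) \<Rightarrow> int \<Rightarrow> complex" where
  "shear_adj \<mu> u m =
     \<i> / 2 * (2 * of_int m * u m - (of_int (m + 1) + \<mu>) * u (m + 1) - (of_int (m - 1) - \<mu>) * u (m - 1))"

text \<open>The coefficients of the adjoint combine into a second difference of \<open>m * u m\<close> and first differences of \<open>u\<close>.\<close>

lemma int_symbol_shear_adj:
  assumes "int_symbol d u"
  shows "int_symbol (d + 1) (\<lambda>w. shear_adj \<mu> (u w))"
proof -
  let ?D = "\<lambda>(u :: complex \<Rightarrow> int \<Rightarrow> complex) w m. u w (m + 1) - u w m"
  let ?S = "\<lambda>(u :: complex \<Rightarrow> int \<Rightarrow> complex) w m. u w (m + - 1)"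
  let ?g = "\<lambda>w m. of_int m * u w m"
  have "int_symbol (d - 1 + 1 + 1) (?S (?D (?D ?g)))"
    by (intro int_symbol_shift[of _ "?D (?D ?g)"] int_symbol_fdiff[of _ "?D ?g"]
        int_symbol_fdiff[of _ ?g] int_symbol_times_index assms) auto
  then have 1: "int_symbol (d + 1) (?S (?D (?D ?g)))" by simp
  have 2: "int_symbol (d + 1) (?D u)"
    by (intro int_symbol_fdiff assms)
  have 3: "int_symbol (d + 1) (?S (?D u))"
    by (intro int_symbol_shift[of _ "?D u"] int_symbol_fdiff assms) auto
  have "int_symbol (d + 1) (\<lambda>w m. (- \<i> / 2) * (?S (?D (?D ?g)) w m) + (- \<i> * \<mu> / 2) * (?D u w m + ?S (?D u) w m))"
    by (intro int_symbol_add int_symbol_cmult 1 2 3)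
  moreover have "(\<lambda>w. shear_adj \<mu> (u w))
      = (\<lambda>w m. (- \<i> / 2) * (?S (?D (?D ?g)) w m) + (- \<i> * \<mu> / 2) * (?D u w m + ?S (?D u) w m))"
    by (intro ext) (simp add: shear_adj_def field_simps)
  ultimately show ?thesis by simp
qed

section \<open>Absolutely convergent pairings and summation by parts\<close>

lemma summable_on_int_powr:
  assumes "e < - 1"
  shows "(\<lambda>m::int. (1 + real_of_int \<bar>m\<bar>) powr e) summable_on UNIV"
proof -
  have "summable (\<lambda>n. real (Suc n) powr e)"
    using assms by (subst summable_Suc_iff) (simp add: summable_real_powr_iff)
  then have "summable (\<lambda>n. norm ((1 + real n) powr e))" by simp
  then have nat: "(\<lambda>n. (1 + real n) powr e) summable_on UNIV"
    by (rule norm_summable_imp_summable_on)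
  have "(\<lambda>m::int. (1 + real_of_int \<bar>m\<bar>) powr e) summable_on range int"
    by (subst summable_on_reindex) (auto simp: o_def nat)
  moreover have "(\<lambda>m::int. (1 + real_of_int \<bar>m\<bar>) powr e) summable_on range (\<lambda>n. - int n)"
    by (subst summable_on_reindex) (auto simp: o_def nat inj_on_def)
  ultimately have "(\<lambda>m::int. (1 + real_of_int \<bar>m\<bar>) powr e) summable_on (range int \<union> range (\<lambda>n. - int n))"
    by (rule summable_on_union)
  moreover have "range int \<union> range (\<lambda>n. - int n) = UNIV"
  proof -
    have "m \<in> range int \<union> range (\<lambda>n. - int n)" for m :: int
      by (cases m rule: int_cases2) auto
    then show ?thesis by auto
  qed
  ultimately show ?thesis by simp
qed

lemma summable_on_int_mult_powr:
  fixes b u :: "int \<Rightarrow> complex"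
  assumes b: "\<And>m. norm (b m) \<le> C * (1 + real_of_int \<bar>m\<bar>) powr M"
    and u: "\<And>m. norm (u m) \<le> D * (1 + real_of_int \<bar>m\<bar>) powr s"
    and "M + s < - 1"
  shows "(\<lambda>m. b m * u m) summable_on UNIV"
proof -
  have "norm (b m * u m) \<le> C * D * (1 + real_of_int \<bar>m\<bar>) powr (M + s)" for m
  proof -
    have "C * (1 + real_of_int \<bar>m\<bar>) powr M \<ge> 0" using b[of m] norm_ge_zero order_trans by blast
    then have "norm (b m * u m) \<le> (C * (1 + real_of_int \<bar>m\<bar>) powr M) * (D * (1 + real_of_int \<bar>m\<bar>) powr s)"
      unfolding norm_mult using b[of m] u[of m] by (intro mult_mono) auto
    then show ?thesis by (simp add: powr_add mult_ac)
  qed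
  moreover have "(\<lambda>m. C * D * (1 + real_of_int \<bar>m\<bar>) powr (M + s)) summable_on UNIV"
    by (intro summable_on_cmult_right summable_on_int_powr assms)
  ultimately have "(\<lambda>m. norm (b m * u m)) summable_on UNIV"
    by (intro Infinite_Sum.abs_summable_on_comparison_test')
  then show ?thesis by (rule Infinite_Sum.abs_summable_summable)
qed

text \<open>Each of the three diagonals converges absolutely, so its index can be shifted on its
  own. The factor \<open>m\<close> in the coefficients costs one power, whence \<open>- 2\<close> in
  place of the \<open>- 1\<close> of \<open>summable_on_int_mult_powr\<close>.\<close>

lemma infsum_shear_op:
  fixes b u :: "int \<Rightarrow> complex"
  assumes b: "\<And>m. norm (b m) \<le> C * (1 + real_of_int \<bar>m\<bar>) powr M"
    and u: "\<And>m. norm (u m) \<le> D * (1 + real_of_int \<bar>m\<bar>) powr s"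
    and lt: "M + s < - 2"
  shows "(\<Sum>\<^sub>\<infinity>m. shear_op \<mu> b m * u m) = (\<Sum>\<^sub>\<infinity>m. b m * shear_adj \<mu> u m)"
proof -
  define L where "L = \<bar>s\<bar>"
  have C: "C \<ge> 0" and D: "D \<ge> 0"
    using order_trans[OF norm_ge_zero b[of 0]] order_trans[OF norm_ge_zero u[of 0]] by simp_all
  have summ: "(\<lambda>m. b m * ((of_int m + c) * u (m + k))) summable_on UNIV" if k: "\<bar>k\<bar> \<le> 1" for c k
  proof (rule summable_on_int_mult_powr[OF b])
    show "M + (1 + s) < - 1" using lt by simp
    fix m :: int
    define x where "x = 1 + real_of_int \<bar>m\<bar>"
    have x: "x \<ge> 1" by (simp add: x_def)
    have "norm (of_int m + c) \<le> norm (of_int m :: complex) + norm c" by (rule norm_triangle_ineq)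
    also have "\<dots> \<le> x + norm c * x"
      using x mult_left_mono[of 1 x "norm c"] by (auto simp: x_def)
    finally have 1: "norm (of_int m + c) \<le> (1 + norm c) * x" by (simp add: algebra_simps)
    have "norm (u (m + k)) \<le> D * (2 powr L * x powr s)"
      using u[of "m + k"] mult_left_mono[OF abs_shift_powr_le[OF k, of s L m] D] by (simp add: L_def x_def)
    with 1 have "norm (of_int m + c) * norm (u (m + k)) \<le> ((1 + norm c) * x) * (D * (2 powr L * x powr s))"
      using x by (intro mult_mono) auto
    then show "norm ((of_int m + c) * u (m + k)) \<le> ((1 + norm c) * D * 2 powr L) * (1 + real_of_int \<bar>m\<bar>) powr (1 + s)"
      unfolding x_def[symmetric] using x by (simp add: norm_mult powr_add mult_ac)
  qed
  \<comment> \<open>The three diagonals as they occur in \<open>shear_adj\<close>. Shifting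
    \<open>f2\<close> by \<open>- 1\<close> and \<open>f3\<close> by 1 turns their coefficients into
    the \<open>m + \<mu>\<close> and \<open>m - \<mu>\<close> of \<open>shear_op\<close>.\<close>
  define f1 where "f1 = (\<lambda>m. b m * (of_int m * u m))"
  define f2 where "f2 = (\<lambda>m. b m * ((of_int m + (1 + \<mu>)) * u (m + 1)))"
  define f3 where "f3 = (\<lambda>m. b m * ((of_int m + (- 1 - \<mu>)) * u (m + - 1)))"
  have "f1 summable_on UNIV" "f2 summable_on UNIV" "f3 summable_on UNIV"
    unfolding f1_def f2_def f3_def
    using summ[of 0 0] summ[of 1 "1 + \<mu>"] summ[of "- 1" "- 1 - \<mu>"] by simp_all
  then obtain S1 S2 S3 where S1: "(f1 has_sum S1) UNIV" and S2: "(f2 has_sum S2) UNIV"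
    and S3: "(f3 has_sum S3) UNIV"
    unfolding summable_on_def by blast
  have shift: "bij_betw (\<lambda>m. m + k) UNIV UNIV" for k :: int
    by (rule bij_betwI[of _ _ _ "\<lambda>m. m - k"]) auto
  have S2': "((\<lambda>m. f2 (m + - 1)) has_sum S2) UNIV"
    using S2 has_sum_reindex_bij_betw[OF shift, of f2 "- 1" S2] by simp
  have S3': "((\<lambda>m. f3 (m + 1)) has_sum S3) UNIV"
    using S3 has_sum_reindex_bij_betw[OF shift, of f3 1 S3] by simp
  have "((\<lambda>m. \<i> / 2 * (2 * f1 m + - f2 (m + - 1) + - f3 (m + 1))) has_sum \<i> / 2 * (2 * S1 + - S2 + - S3)) UNIV"
    using S2' S3' by (intro has_sum_cmult_right has_sum_add S1) (simp_all add: has_sum_uminus)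
  then have 1: "((\<lambda>m. shear_op \<mu> b m * u m) has_sum \<i> / 2 * (2 * S1 + - S2 + - S3)) UNIV"
    by (rule has_sum_cong[THEN iffD1, rotated]) (simp add: shear_op_def f1_def f2_def f3_def algebra_simps)
  have "((\<lambda>m. \<i> / 2 * (2 * f1 m + - f2 m + - f3 m)) has_sum \<i> / 2 * (2 * S1 + - S2 + - S3)) UNIV"
    using S2 S3 by (intro has_sum_cmult_right has_sum_add S1) (simp_all add: has_sum_uminus)
  then have 2: "((\<lambda>m. b m * shear_adj \<mu> u m) has_sum \<i> / 2 * (2 * S1 + - S2 + - S3)) UNIV"
    by (rule has_sum_cong[THEN iffD1, rotated]) (simp add: shear_adj_def f1_def f2_def f3_def algebra_simps)
  show ?thesis using 1 2 by (simp add: infsumI)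
qed

lemma holomorphic_infsum_symbol:
  fixes b :: "int \<Rightarrow> complex"
  assumes b: "\<And>m. norm (b m) \<le> C * (1 + real_of_int \<bar>m\<bar>) powr M"
    and u: "int_symbol d u"
  shows "(\<lambda>w. \<Sum>\<^sub>\<infinity>m. b m * u w m) holomorphic_on {w. Re w > M + 1 - d}"
proof -
  let ?S = "{w. Re w > M + 1 - d}"
  have C: "C \<ge> 0" using order_trans[OF norm_ge_zero b[of 0]] by simp
  have "\<exists>r>0. (\<lambda>w. \<Sum>\<^sub>\<infinity>m. b m * u w m) holomorphic_on ball z r" if z: "z \<in> ?S" for z
  proof -
    \<comment> \<open>Half the distance from \<open>z\<close> to the boundary line, so that on the
      disc the summands decay at least with exponent \<open>e = - 1 - r\<close>, as the M-test
      requires.\<close>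
    define r where "r = (Re z - (M + 1 - d)) / 2"
    have r: "r > 0" using z by (simp add: r_def)
    define e where "e = M - (Re z - r) - d"
    have e: "e < - 1" using z by (simp add: e_def r_def field_simps)
    obtain D where D: "D \<ge> 0" "\<And>w m. norm w \<le> norm z + r \<Longrightarrow>
        norm (fdiff 0 (u w) m) \<le> D * (1 + real_of_int \<bar>m\<bar>) powr (- Re w - d - real 0)"
      using int_symbolE[OF u] by metis
    have bound: "norm (b m * u w m) \<le> C * D * (1 + real_of_int \<bar>m\<bar>) powr e" if w: "w \<in> cball z r" for w m
    proof -
      define x where "x = 1 + real_of_int \<bar>m\<bar>"
      have x: "x \<ge> 1" by (simp add: x_def)
      have wz: "norm (w - z) \<le> r" using w by (simp add: dist_norm norm_minus_commute)
      have "norm w \<le> norm z + r" using wz norm_triangle_sub[of w z] by simp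
      from D(2)[OF this, of m] have uw: "norm (u w m) \<le> D * x powr (- Re w - d)" by (simp add: x_def)
      have "Re z - r \<le> Re w" using wz abs_Re_le_cmod[of "w - z"] by simp
      then have "x powr (- Re w - d) \<le> x powr (- (Re z - r) - d)" using x by (intro powr_mono) auto
      then have "norm (u w m) \<le> D * x powr (- (Re z - r) - d)"
        using uw D(1) by (meson mult_left_mono order_trans)
      then have "norm (b m * u w m) \<le> (C * x powr M) * (D * x powr (- (Re z - r) - d))"
        unfolding norm_mult using b[of m] C x by (intro mult_mono) (auto simp: x_def)
      also have "\<dots> = C * D * (x powr M * x powr (- (Re z - r) - d))" by (simp add: mult_ac)
      also have "x powr M * x powr (- (Re z - r) - d) = x powr e"
        unfolding powr_add[symmetric] by (rule arg_cong[of _ _ "(powr) x"]) (simp add: e_def)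
      finally show ?thesis by (simp only: x_def)
    qed
    have "uniform_limit (cball z r) (\<lambda>X w. \<Sum>m\<in>X. b m * u w m) (\<lambda>w. \<Sum>\<^sub>\<infinity>m. b m * u w m)
        (finite_subsets_at_top UNIV)"
      by (rule Weierstrass_m_test_general[where M = "\<lambda>m. C * D * (1 + real_of_int \<bar>m\<bar>) powr e"])
        (use bound e in \<open>auto intro!: summable_on_cmult_right summable_on_int_powr simp del: of_int_abs\<close>)
    moreover have "(\<lambda>w. \<Sum>m\<in>X. b m * u w m) holomorphic_on A" for X A
      by (intro holomorphic_intros holomorphic_on_subset[OF int_symbol_holo[OF u]]) auto
    ultimately show ?thesis
      using r by (intro exI[of _ r] conjI)
        (auto intro!: holomorphic_on_imp_continuous_on always_eventually
          elim!: holomorphic_uniform_limit[rotated])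
  qed
  then show ?thesis
    by (meson holomorphic_on_open open_halfspace_Re_gt analytic_on_def analytic_imp_holomorphic)
qed

section \<open>Continuation by repeated summation by parts\<close>

text \<open>\<open>G k\<close> pairs \<open>b k\<close> with the \<open>k\<close>-fold image of
  \<open>abs_powr_symbol\<close> under \<open>shear_adj\<close>, a symbol with gain
  \<open>k\<close>, so it is holomorphic for \<open>Re w > M + 1 - k\<close>. One unit further right
  summation by parts is legitimate and gives \<open>G (Suc k) = G k\<close>; hence the
  \<open>G k\<close> glue to an entire function.\<close>

lemma entire_continuation:
  fixes b :: "nat \<Rightarrow> int \<Rightarrow> complex"
  assumes step: "\<And>k m. shear_op \<mu> (b (Suc k)) m = b k m"
    and bound: "\<And>k. \<exists>C. \<forall>m. norm (b k m) \<le> C * (1 + real_of_int \<bar>m\<bar>) powr M"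
  obtains F where "F holomorphic_on UNIV"
    "\<And>w. Re w > M + 2 \<Longrightarrow> (\<lambda>m. b 0 m * abs_powr_symbol w m) summable_on UNIV"
    "\<And>w. Re w > M + 2 \<Longrightarrow> F w = (\<Sum>\<^sub>\<infinity>m. b 0 m * abs_powr_symbol w m)"
proof -
  obtain C where C: "\<And>k m. norm (b k m) \<le> C k * (1 + real_of_int \<bar>m\<bar>) powr M"
    using bound by metis
  define u where "u k w = (shear_adj \<mu> ^^ k) (abs_powr_symbol w)" for k w
  have u: "int_symbol (real k) (u k)" for k
  proof (induction k)
    case 0
    show ?case using int_symbol_abs_powr by (simp add: u_def)
  next
    case (Suc k)
    from int_symbol_shear_adj[OF Suc, of \<mu>] show ?case by (simp add: u_def add.commute)
  qed
  have ubound: "\<exists>D. \<forall>m. norm (u k w m) \<le> D * (1 + real_of_int \<bar>m\<bar>) powr (- Re w - real k)" for k w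
    using int_symbolE[OF u[of k], of "norm w" 0] by (metis diff_zero fdiff.simps(1) of_nat_0 order_refl)
  define G where "G k w = (\<Sum>\<^sub>\<infinity>m. b k m * u k w m)" for k w
  have holo: "G k holomorphic_on {w. Re w > M + 1 - real k}" for k
    unfolding G_def by (rule holomorphic_infsum_symbol[OF C u])
  have G_Suc: "G (Suc k) w = G k w" if "Re w > M + 2 - real k" for k w
  proof -
    obtain D where "\<And>m. norm (u k w m) \<le> D * (1 + real_of_int \<bar>m\<bar>) powr (- Re w - real k)"
      using ubound by blast
    from infsum_shear_op[where \<mu> = \<mu>, OF C[of "Suc k"] this] that
    show ?thesis by (simp add: G_def u_def step)
  qed
  have G_add: "G (k + j) w = G k w" if "Re w > M + 2 - real k" for k j w
    using that by (induction j) (auto simp: G_Suc)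
  have G_eq: "G k w = G j w" if "Re w > M + 2 - real k" "Re w > M + 2 - real j" for k j w
    using that G_add[of k w "j - k"] G_add[of j w "k - j"] by (cases "k \<le> j") auto
  \<comment> \<open>Any index whose half-plane contains \<open>w\<close> would do, since all of them
    give the same value by \<open>G_eq\<close>.\<close>
  define N where "N w = nat \<lceil>M + 3 - Re w\<rceil>" for w :: complex
  have N: "Re w > M + 2 - real (N w)" for w unfolding N_def by linarith
  define F where "F w = G (N w) w" for w
  have F: "F w = G k w" if "Re w > M + 2 - real k" for w k
    unfolding F_def by (intro G_eq N that)
  have "F holomorphic_on (\<Union>k. {w. Re w > M + 2 - real k})"
  proof (rule holomorphic_on_UN_open)
    fix k
    have "G k holomorphic_on {w. Re w > M + 2 - real k}"
      by (rule holomorphic_on_subset[OF holo]) auto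
    then show "F holomorphic_on {w. Re w > M + 2 - real k}"
      by (rule holomorphic_transform) (auto simp: F)
  qed (auto simp: open_halfspace_Re_gt)
  moreover have "(\<Union>k. {w. Re w > M + 2 - real k}) = UNIV" using N by auto
  ultimately have "F holomorphic_on UNIV" by simp
  moreover have "(\<lambda>m. b 0 m * abs_powr_symbol w m) summable_on UNIV" if w: "Re w > M + 2" for w
  proof -
    obtain D where "\<And>m. norm (u 0 w m) \<le> D * (1 + real_of_int \<bar>m\<bar>) powr (- Re w - real 0)"
      using ubound by blast
    from summable_on_int_mult_powr[OF C this, of 0] w show ?thesis by (simp add: u_def)
  qed
  moreover have "F w = (\<Sum>\<^sub>\<infinity>m. b 0 m * abs_powr_symbol w m)" if "Re w > M + 2" for w
    using F[of 0 w] that by (simp add: G_def u_def)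
  ultimately show thesis by (rule that)
qed

section \<open>Calculus of iterated derivatives\<close>

lemma iter_deriv_append: "iter_deriv (vs @ ws) f = iter_deriv vs (iter_deriv ws f)"
  by (induction vs) auto

lemma has_derivative_cong_open:
  assumes "open S" "x \<in> S" "\<And>y. y \<in> S \<Longrightarrow> f y = g y"
  shows "(f has_derivative D) (at x) \<longleftrightarrow> (g has_derivative D) (at x)"
  using assms has_derivative_transform_within_open[of f D x UNIV S g]
    has_derivative_transform_within_open[of g D x UNIV S f] by auto

lemma Cinf_on_differentiable: "Cinf_on S f \<Longrightarrow> x \<in> S \<Longrightarrow> iter_deriv vs f differentiable (at x)"
  by (auto simp: Cinf_on_def)

lemma Cinf_on_has_derivative:
  "Cinf_on S f \<Longrightarrow> x \<in> S \<Longrightarrow>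
     (iter_deriv vs f has_derivative (\<lambda>v. iter_deriv (v # vs) f x)) (at x)"
  using frechet_derivative_works[of "iter_deriv vs f" "at x"] by (auto simp: Cinf_on_def)

lemma Cinf_on_imp_continuous_on:
  assumes "Cinf_on S f"
  shows "continuous_on S (iter_deriv vs f)"
  using Cinf_on_differentiable[OF assms]
  by (auto intro!: continuous_at_imp_continuous_on differentiable_imp_continuous_within)

text \<open>Candidates \<open>E vs\<close> for all iterated derivatives are verified one first-order
  derivative at a time, the head of the list being the derivative taken last. Explicit formulas thus
  replace any differentiation of \<open>frechet_derivative\<close> itself.\<close>

lemma iter_deriv_eqI:
  assumes S: "open S" and base: "\<And>x. x \<in> S \<Longrightarrow> f x = E [] x"
    and step: "\<And>vs x. x \<in> S \<Longrightarrow> (E vs has_derivative (\<lambda>v. E (v # vs) x)) (at x)"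
  shows "x \<in> S \<Longrightarrow> iter_deriv vs f x = E vs x"
    and Cinf_onI: "Cinf_on S f"
proof -
  have eq: "iter_deriv vs f x = E vs x" if "x \<in> S" for x vs
    using that
  proof (induction vs arbitrary: x)
    case (Cons v vs)
    have "(iter_deriv vs f has_derivative (\<lambda>v. E (v # vs) x)) (at x)"
      using has_derivative_cong_open[where f = "iter_deriv vs f" and g = "E vs", OF S Cons.prems Cons.IH]
        step[OF Cons.prems] by blast
    from frechet_derivative_at[OF this] show ?case by (simp add: fun_eq_iff)
  qed (use base in simp)
  show "x \<in> S \<Longrightarrow> iter_deriv vs f x = E vs x" by (rule eq)
  show "Cinf_on S f"
    unfolding Cinf_on_def differentiable_def
    using has_derivative_cong_open[where f = "iter_deriv vs f" and g = "E vs" for vs, OF S _ eq] step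
    by blast
qed

text \<open>For functions that agree near a point the choice predicates behind
  \<open>frechet_derivative\<close> coincide, so the chosen values agree whether or not a derivative
  exists.\<close>

lemma iter_deriv_cong:
  assumes "open S" "\<And>y. y \<in> S \<Longrightarrow> f y = g y" "x \<in> S"
  shows "iter_deriv vs f x = iter_deriv vs g x"
  using assms(3)
proof (induction vs arbitrary: x)
  case (Cons v vs)
  then show ?case
    using has_derivative_cong_open[where f = "iter_deriv vs f" and g = "iter_deriv vs g",
        OF assms(1) Cons.prems Cons.IH]
    by (simp add: frechet_derivative_def)
qed (use assms in simp)

text \<open>Inside a class closed under directional derivatives, a derivative operator
  \<open>d\<close> can be chosen and iterated along the list of directions; this yields the
  candidates for \<open>Cinf_onI\<close>.\<close>

lemma Cinf_on_coinduct:
  assumes S: "open S" and f: "f \<in> \<F>"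
    and step: "\<And>f. f \<in> \<F> \<Longrightarrow>
      \<exists>g. (\<forall>v. (\<lambda>x. g x v) \<in> \<F>) \<and> (\<forall>x\<in>S. (f has_derivative g x) (at x))"
  shows "Cinf_on S f"
proof -
  obtain d where d: "\<And>f v. f \<in> \<F> \<Longrightarrow> (\<lambda>x. d f x v) \<in> \<F>"
    "\<And>f x. f \<in> \<F> \<Longrightarrow> x \<in> S \<Longrightarrow> (f has_derivative d f x) (at x)"
    using step by metis
  define E where "E = rec_list f (\<lambda>v vs g x. d g x v)"
  have E: "E vs \<in> \<F>" for vs
    by (induction vs) (auto simp: E_def f d(1))
  show ?thesis
    by (rule Cinf_onI[where E = E]) (use S d(2)[OF E] in \<open>auto simp: E_def\<close>)
qed

lemma
  assumes "open S" "Cinf_on S f" "Cinf_on S g"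
  shows iter_deriv_add: "x \<in> S \<Longrightarrow> iter_deriv vs (\<lambda>x. f x + g x) x = iter_deriv vs f x + iter_deriv vs g x"
    and Cinf_on_add: "Cinf_on S (\<lambda>x. f x + g x)"
  using iter_deriv_eqI[where f = "\<lambda>x. f x + g x" and E = "\<lambda>vs x. iter_deriv vs f x + iter_deriv vs g x", OF assms(1)]
    has_derivative_add[OF Cinf_on_has_derivative[OF assms(2)] Cinf_on_has_derivative[OF assms(3)]]
  by simp_all

lemma
  assumes "bounded_linear L" "open S" "Cinf_on S f"
  shows iter_deriv_bounded_linear: "x \<in> S \<Longrightarrow> iter_deriv vs (\<lambda>x. L (f x)) x = L (iter_deriv vs f x)"
    and Cinf_on_bounded_linear: "Cinf_on S (\<lambda>x. L (f x))"
  using iter_deriv_eqI[where f = "\<lambda>x. L (f x)" and E = "\<lambda>vs x. L (iter_deriv vs f x)", OF assms(2)]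
    bounded_linear.has_derivative[OF assms(1) Cinf_on_has_derivative[OF assms(3)]]
  by simp_all

lemmas iter_deriv_cmult = iter_deriv_bounded_linear[OF bounded_linear_mult_right]
lemmas Cinf_on_cmult = Cinf_on_bounded_linear[OF bounded_linear_mult_right]

text \<open>By the chain rule a derivative of the composite along \<open>v\<close> is one of
  \<open>f\<close> along \<open>A v\<close>, so the list of directions is pushed forward by
  \<open>A\<close>.\<close>

lemma Cinf_on_compose:
  assumes "bounded_linear A" "open S" "Cinf_on S f"
  shows "Cinf_on (A -` S) (\<lambda>x. f (A x))"
proof -
  have op: "open (A -` S)"
    using assms(1,2) by (intro open_vimage linear_continuous_on)
  have "((\<lambda>x. iter_deriv (map A vs) f (A x)) has_derivative (\<lambda>v. iter_deriv (A v # map A vs) f (A x))) (at x)"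
    if "x \<in> A -` S" for x vs
    using has_derivative_compose[OF bounded_linear_imp_has_derivative[OF assms(1)]
      Cinf_on_has_derivative[OF assms(3), of "A x" "map A vs"]] that by simp
  from Cinf_onI[where f = "\<lambda>x. f (A x)" and E = "\<lambda>vs x. iter_deriv (map A vs) f (A x)",
      OF op _ this[unfolded list.map(2)[symmetric]]]
  show ?thesis by simp
qed

section \<open>Derivatives of the basis vectors\<close>

definition cpl :: "real^2 \<Rightarrow> complex" where
  "cpl x = Complex (x $ 1) (x $ 2)"

lemma linear_cpl: "linear cpl"
  by (rule linearI) (auto simp: cpl_def complex_eq_iff)

lemma bounded_linear_cpl: "bounded_linear cpl"
  using linear_cpl linear_conv_bounded_linear by blast

lemma norm_cpl [simp]: "norm (cpl x) = norm x"
  by (simp add: cpl_def norm_vec_def L2_set_def UNIV_2 cmod_def)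

lemma cpl_eq_0_iff [simp]: "cpl x = 0 \<longleftrightarrow> x = 0"
  using norm_cpl[of x] by (metis norm_eq_zero)

lemma inner_cpl: "of_real (x \<bullet> v) = (cnj (cpl x) * cpl v + cpl x * cnj (cpl v)) / 2"
  by (simp add: cpl_def complex_eq_iff inner_vec_def UNIV_2)

text \<open>With \<open>z = cpl x\<close> the right side is \<open>|z|^(\<tau>-1-n) * z^n\<close>.
  Since \<open>n\<close> is an integer, the branch cut of \<open>Arg\<close> disappears and the
  formula can be differentiated everywhere off 0.\<close>

lemma PS_basis_eq:
  assumes "x \<noteq> 0"
  shows "PS_basis \<tau> n x = exp ((\<tau> - 1 - of_int n) * of_real (ln (norm x))) * cpl x powi n"
proof -
  have "cis (of_int n * Arg (cpl x)) = cis (Arg (cpl x)) powi n"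
    by (simp add: cis_power_int mult.commute)
  also have "cis (Arg (cpl x)) = cpl x / of_real (norm x)"
    using assms by (simp add: cis_Arg sgn_div_norm scaleR_conv_of_real field_simps)
  also have "of_real (norm x) = exp (of_real (ln (norm x)) :: complex)"
    using assms by (simp add: exp_of_real)
  finally have "cis (of_int n * Arg (cpl x)) = cpl x powi n / exp (of_int n * of_real (ln (norm x)))"
    by (simp add: power_int_divide_distrib exp_power_int)
  then show ?thesis
    using assms by (simp add: PS_basis_def powr_def Ln_of_real cpl_def[symmetric] algebra_simps exp_diff exp_add)
qed

lemma norm_PS_basis: "x \<noteq> 0 \<Longrightarrow> norm (PS_basis \<tau> n x) = norm x powr (Re \<tau> - 1)"
  by (simp add: PS_basis_def norm_mult norm_powr_real_powr)

text \<open>Formally \<open>PS_basis \<tau> n\<close> is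
  \<open>z^((s+n)/2) * (cnj z)^((s-n)/2)\<close> with \<open>s = \<tau> - 1\<close>; the
  coefficients of \<open>cpl v\<close> and \<open>cnj (cpl v)\<close> are its Wirtinger derivatives.
  They lower the degree by 1 and move \<open>n\<close> by 1 down or up.\<close>

definition PS_deriv :: "complex \<Rightarrow> int \<Rightarrow> real^2 \<Rightarrow> real^2 \<Rightarrow> complex" where
  "PS_deriv \<tau> n x v = (\<tau> - 1 + of_int n) / 2 * cpl v * PS_basis (\<tau> - 1) (n - 1) x
     + (\<tau> - 1 - of_int n) / 2 * cnj (cpl v) * PS_basis (\<tau> - 1) (n + 1) x"

lemma PS_basis_has_derivative:
  assumes "x \<noteq> 0"
  shows "(PS_basis \<tau> n has_derivative PS_deriv \<tau> n x) (at x)"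
proof -
  let ?l = "\<tau> - 1 - of_int n"
  let ?E = "exp (?l * of_real (ln (norm x)))"
  let ?z = "cpl x"
  have z: "?z \<noteq> 0" using assms by simp
  have nz: "complex_of_real (norm x) ^ 2 = ?z * cnj ?z"
    using complex_norm_square[of "cpl x"] by simp
  have dn: "(norm has_derivative (\<lambda>v. v \<bullet> sgn x)) (at x)"
    using assms by (rule has_derivative_norm)
  have "((\<lambda>x. ln (norm x)) has_derivative (\<lambda>v. v \<bullet> sgn x / norm x)) (at x)"
    using assms by (auto intro!: derivative_eq_intros dn simp: field_simps)
  from bounded_linear.has_derivative[OF bounded_linear_of_real this]
  have dl: "((\<lambda>x. complex_of_real (ln (norm x))) has_derivative (\<lambda>v. of_real (v \<bullet> sgn x / norm x))) (at x)" .
  have "((\<lambda>y. exp (?l * y)) has_field_derivative ?l * ?E) (at (of_real (ln (norm x))))"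
    by (auto intro!: derivative_eq_intros)
  from has_derivative_compose[OF dl this[unfolded has_field_derivative_def]]
  have d1: "((\<lambda>x. exp (?l * of_real (ln (norm x)))) has_derivative
      (\<lambda>v. ?l * ?E * of_real (v \<bullet> sgn x / norm x))) (at x)" .
  have "((\<lambda>y. y powi n) has_field_derivative of_int n * ?z powi (n - 1)) (at ?z)"
    using z by (auto intro!: derivative_eq_intros)
  from has_derivative_compose[OF bounded_linear_imp_has_derivative[OF bounded_linear_cpl]
      this[unfolded has_field_derivative_def]]
  have d2: "((\<lambda>x. cpl x powi n) has_derivative (\<lambda>v. of_int n * ?z powi (n - 1) * cpl v)) (at x)" .
  have "((\<lambda>x. exp (?l * of_real (ln (norm x))) * cpl x powi n) has_derivative
      (\<lambda>v. ?E * (of_int n * ?z powi (n - 1) * cpl v) + ?l * ?E * of_real (v \<bullet> sgn x / norm x) * ?z powi n)) (at x)"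
    by (rule has_derivative_mult[OF d1 d2])
  moreover have "(\<lambda>v. ?E * (of_int n * ?z powi (n - 1) * cpl v) + ?l * ?E * of_real (v \<bullet> sgn x / norm x) * ?z powi n)
      = PS_deriv \<tau> n x"
  proof
    fix v
    \<comment> \<open>All terms are expressed through \<open>?E\<close>, one power of
      \<open>?z\<close>, \<open>?z\<close> and \<open>cnj ?z\<close>, using
      \<open>|z|^2 = z * cnj z\<close>; the claim is then an identity of rational
      expressions.\<close>
    have e1: "exp ((\<tau> - 1 - 1 - of_int (n - 1)) * of_real (ln (norm x))) = ?E"
      by (rule arg_cong[of _ _ exp]) (simp add: algebra_simps)
    have "exp ((\<tau> - 1 - 1 - of_int (n + 1)) * of_real (ln (norm x)))
        = ?E / exp (of_real (ln (norm x))) ^ 2"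
      by (simp add: power2_eq_square algebra_simps exp_diff exp_add[symmetric])
    also have "exp (of_real (ln (norm x))) = complex_of_real (norm x)"
      using assms by (simp add: exp_of_real)
    finally have e2: "exp ((\<tau> - 1 - 1 - of_int (n + 1)) * of_real (ln (norm x))) = ?E / (?z * cnj ?z)"
      by (simp add: nz)
    have "complex_of_real (v \<bullet> sgn x / norm x) = of_real (x \<bullet> v) / of_real (norm x) ^ 2"
      by (simp add: sgn_div_norm inner_commute power2_eq_square field_simps)
    then have e3: "complex_of_real (v \<bullet> sgn x / norm x) = (cnj ?z * cpl v + ?z * cnj (cpl v)) / 2 / (?z * cnj ?z)"
      by (simp only: nz inner_cpl)
    have p: "?z powi n = ?z powi (n - 1) * ?z" "?z powi (n + 1) = ?z powi (n - 1) * ?z * ?z"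
      using z by (simp_all add: power_int_add power_int_diff)
    show "?E * (of_int n * ?z powi (n - 1) * cpl v) + ?l * ?E * of_real (v \<bullet> sgn x / norm x) * ?z powi n
        = PS_deriv \<tau> n x v"
      unfolding PS_deriv_def PS_basis_eq[OF assms] e1 e2 e3 p using z
      by (simp add: field_simps)
  qed
  ultimately show ?thesis
    using has_derivative_cong_open[of "- {0}" x "PS_basis \<tau> n" "\<lambda>x. exp (?l * of_real (ln (norm x))) * cpl x powi n"]
      assms PS_basis_eq by auto
qed

text \<open>Here \<open>\<tau>\<close> and \<open>n\<close> range over all values: differentiation
  lowers \<open>\<tau>\<close> and moves \<open>n\<close>, so only such a mixed span is closed under
  derivatives, as \<open>Cinf_on_coinduct\<close> requires.\<close>

inductive_set PS_span :: "(real^2 \<Rightarrow> complex) set" where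
  basis: "(\<lambda>x. c * PS_basis \<tau> n x) \<in> PS_span"
| add: "f \<in> PS_span \<Longrightarrow> g \<in> PS_span \<Longrightarrow> (\<lambda>x. f x + g x) \<in> PS_span"

lemma PS_span_deriv:
  assumes "f \<in> PS_span"
  shows "\<exists>g. (\<forall>v. (\<lambda>x. g x v) \<in> PS_span) \<and> (\<forall>x. x \<noteq> 0 \<longrightarrow> (f has_derivative g x) (at x))"
  using assms
proof induction
  case (basis c \<tau> n)
  have "(\<lambda>x. c * PS_deriv \<tau> n x v) \<in> PS_span" for v
    using PS_span.add[OF PS_span.basis[of "c * ((\<tau> - 1 + of_int n) / 2 * cpl v)" "\<tau> - 1" "n - 1"]
      PS_span.basis[of "c * ((\<tau> - 1 - of_int n) / 2 * cnj (cpl v))" "\<tau> - 1" "n + 1"]]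
    by (simp add: PS_deriv_def algebra_simps)
  then show ?case
    by (intro exI[of _ "\<lambda>x v. c * PS_deriv \<tau> n x v"])
      (auto intro!: has_derivative_mult_right PS_basis_has_derivative)
next
  case (add f g)
  then obtain f' g' where "\<And>v. (\<lambda>x. f' x v) \<in> PS_span" "\<And>x. x \<noteq> 0 \<Longrightarrow> (f has_derivative f' x) (at x)"
    "\<And>v. (\<lambda>x. g' x v) \<in> PS_span" "\<And>x. x \<noteq> 0 \<Longrightarrow> (g has_derivative g' x) (at x)"
    by metis
  then show ?case
    by (intro exI[of _ "\<lambda>x v. f' x v + g' x v"]) (auto intro!: has_derivative_add PS_span.add)
qed

lemma Cinf_on_PS_basis: "Cinf_on (- {0}) (PS_basis \<tau> n)"
proof (rule Cinf_on_coinduct[where \<F> = PS_span])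
  show "PS_basis \<tau> n \<in> PS_span" using PS_span.basis[of 1 \<tau> n] by simp
  show "\<exists>g. (\<forall>v. (\<lambda>x. g x v) \<in> PS_span) \<and> (\<forall>x\<in>- {0}. (f has_derivative g x) (at x))"
    if "f \<in> PS_span" for f
    using PS_span_deriv[OF that] by (simp only: Ball_def Compl_iff singleton_iff)
qed auto

text \<open>Peels off the derivative taken first, which stays in the family. Induction from the
  right end of the list can then work with explicit coefficients.\<close>

lemma iter_deriv_PS_basis_snoc:
  assumes "x \<noteq> 0"
  shows "iter_deriv (vs @ [v]) (PS_basis \<tau> n) x
    = (\<tau> - 1 + of_int n) / 2 * cpl v * iter_deriv vs (PS_basis (\<tau> - 1) (n - 1)) x
     + (\<tau> - 1 - of_int n) / 2 * cnj (cpl v) * iter_deriv vs (PS_basis (\<tau> - 1) (n + 1)) x"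
proof -
  have op: "open (- {0 :: real^2})" by auto
  have "iter_deriv [v] (PS_basis \<tau> n) y = PS_deriv \<tau> n y v" if "y \<in> - {0}" for y
    using frechet_derivative_at[OF PS_basis_has_derivative[of y \<tau> n]] that by (auto simp: fun_eq_iff)
  then have "iter_deriv (vs @ [v]) (PS_basis \<tau> n) x = iter_deriv vs (\<lambda>y. PS_deriv \<tau> n y v) x"
    unfolding iter_deriv_append using assms by (intro iter_deriv_cong[of "- {0}"]) auto
  also have "\<dots> = (\<tau> - 1 + of_int n) / 2 * cpl v * iter_deriv vs (PS_basis (\<tau> - 1) (n - 1)) x
     + (\<tau> - 1 - of_int n) / 2 * cnj (cpl v) * iter_deriv vs (PS_basis (\<tau> - 1) (n + 1)) x"
    unfolding PS_deriv_def using assms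
    by (simp add: op iter_deriv_add[OF op] iter_deriv_cmult[OF op] Cinf_on_cmult[OF op] Cinf_on_PS_basis
        del: times_divide_eq_left)
  finally show ?thesis .
qed

text \<open>Without derivatives the modulus is \<open>|x|^(Re \<tau> - 1)\<close>, independent of
  \<open>n\<close>; each derivative costs a coefficient linear in \<open>n\<close>. Since each
  derivative also lowers \<open>\<tau>\<close>, the induction keeps \<open>\<tau>\<close>
  arbitrary.\<close>

lemma iter_deriv_PS_basis_bound:
  assumes "compact C" "C \<subseteq> - {0}"
  shows "\<exists>K\<ge>0. \<forall>n. \<forall>x\<in>C. norm (iter_deriv vs (PS_basis \<tau> n) x) \<le> K * (1 + real_of_int \<bar>n\<bar>) ^ length vs"
proof (induction vs arbitrary: \<tau> rule: rev_induct)
  case Nil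
  have "continuous_on C (\<lambda>x. norm x powr (Re \<tau> - 1))"
    using assms(2) by (intro continuous_intros) auto
  from compact_imp_bounded[OF compact_continuous_image[OF this assms(1)]]
  obtain K where "\<forall>y\<in>(\<lambda>x. norm x powr (Re \<tau> - 1)) ` C. norm y \<le> K"
    unfolding bounded_iff by blast
  then have K: "\<And>x. x \<in> C \<Longrightarrow> norm x powr (Re \<tau> - 1) \<le> K" by auto
  show ?case
  proof (intro exI[of _ "max K 0"] conjI allI ballI)
    fix n x assume x: "x \<in> C"
    then have "x \<noteq> 0" using assms(2) by auto
    then show "norm (iter_deriv [] (PS_basis \<tau> n) x) \<le> max K 0 * (1 + real_of_int \<bar>n\<bar>) ^ length []"
      using K[OF x] by (simp add: norm_PS_basis)
  qed auto
next
  case (snoc v vs)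
  let ?k = "length vs"
  obtain K where K: "K \<ge> 0" "\<And>n x. x \<in> C \<Longrightarrow>
      norm (iter_deriv vs (PS_basis (\<tau> - 1) n) x) \<le> K * (1 + real_of_int \<bar>n\<bar>) ^ ?k"
    using snoc[of "\<tau> - 1"] by metis
  \<comment> \<open>There are two terms, each with a coefficient of size at most
    \<open>(norm (\<tau> - 1) + 1) * N / 2\<close> and a factor \<open>norm v\<close>; passing from
    \<open>n\<close> to its neighbours costs \<open>2 ^ ?k\<close>.\<close>
  define L where "L = (norm (\<tau> - 1) + 1) * norm v * (K * 2 ^ ?k)"
  have L: "L \<ge> 0" using K by (auto simp: L_def)
  show ?case
  proof (intro exI[of _ "L"] conjI allI ballI)
    fix n :: int and x assume x: "x \<in> C"
    then have x0: "x \<noteq> 0" using assms(2) by auto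
    define N where "N = 1 + real_of_int \<bar>n\<bar>"
    have N: "N \<ge> 1" by (simp add: N_def)
    have D: "norm (iter_deriv vs (PS_basis (\<tau> - 1) (n + k)) x) \<le> K * 2 ^ ?k * N ^ ?k" if "\<bar>k\<bar> \<le> 1" for k
    proof -
      have "\<bar>n + k\<bar> \<le> \<bar>n\<bar> + 1" using that by linarith
      then have "real_of_int \<bar>n + k\<bar> \<le> real_of_int \<bar>n\<bar> + 1" by linarith
      then have "1 + real_of_int \<bar>n + k\<bar> \<le> 2 * N" using N abs_ge_zero[of n] unfolding N_def by (simp del: of_int_abs)
      then have "(1 + real_of_int \<bar>n + k\<bar>) ^ ?k \<le> (2 * N) ^ ?k"
        by (intro power_mono) auto
      from order_trans[OF K(2)[OF x] mult_left_mono[OF this K(1)]]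
      show ?thesis by (simp add: power_mult_distrib mult_ac)
    qed
    have c: "norm ((\<tau> - 1 + of_int s * of_int n) / 2) \<le> (norm (\<tau> - 1) + 1) * N / 2" if "\<bar>s\<bar> = 1" for s
    proof -
      have "norm (\<tau> - 1 + of_int s * of_int n) \<le> norm (\<tau> - 1) + norm (of_int (s * n) :: complex)"
        using norm_triangle_ineq[of "\<tau> - 1" "of_int (s * n)"] by simp
      also have "norm (of_int (s * n) :: complex) = real_of_int \<bar>n\<bar>"
        using that by (simp only: norm_of_int abs_mult of_int_abs[symmetric])
      also have "norm (\<tau> - 1) + real_of_int \<bar>n\<bar> \<le> (norm (\<tau> - 1) + 1) * N"
        using N mult_left_mono[of 1 N "norm (\<tau> - 1)"] unfolding distrib_right by (simp add: N_def)
      finally show ?thesis by (simp add: norm_divide)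
    qed
    have t: "norm ((\<tau> - 1 + of_int s * of_int n) / 2 * y * iter_deriv vs (PS_basis (\<tau> - 1) (n + k)) x)
        \<le> L / 2 * (N * N ^ ?k)" if "\<bar>s\<bar> = 1" "\<bar>k\<bar> \<le> 1" "norm y = norm v" for s k y
    proof -
      have "norm ((\<tau> - 1 + of_int s * of_int n) / 2 * y * iter_deriv vs (PS_basis (\<tau> - 1) (n + k)) x)
          \<le> (norm (\<tau> - 1) + 1) * N / 2 * norm v * (K * 2 ^ ?k * N ^ ?k)"
        unfolding norm_mult[of "_ * _"] norm_mult[of "_ / _"] using N K(1)
        by (intro mult_mono c D that) (auto simp: that)
      then show ?thesis by (simp add: L_def mult_ac)
    qed
    have "norm (iter_deriv (vs @ [v]) (PS_basis \<tau> n) x) \<le> L / 2 * (N * N ^ ?k) + L / 2 * (N * N ^ ?k)"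
      unfolding iter_deriv_PS_basis_snoc[OF x0]
      using t[of 1 "- 1" "cpl v"] t[of "- 1" 1 "cnj (cpl v)"]
      by (intro norm_triangle_mono) simp_all
    then show "norm (iter_deriv (vs @ [v]) (PS_basis \<tau> n) x) \<le> L * (1 + real_of_int \<bar>n\<bar>) ^ length (vs @ [v])"
      by (simp add: N_def)
  qed (use L in auto)
qed

section \<open>The principal series and the unipotent subgroup\<close>

lemma open_Compl_0: "open (- {0 :: real^2})"
  by auto

text \<open>Evenness of \<open>n\<close> enters through \<open>t^n = |t|^n\<close> for negative
  \<open>t\<close>.\<close>

lemma PS_basis_in_PS_space:
  assumes "even n"
  shows "PS_basis \<tau> n \<in> PS_space \<tau>"
proof -
  have "PS_basis \<tau> n (t *\<^sub>R x) = of_real \<bar>t\<bar> powr (\<tau> - 1) * PS_basis \<tau> n x" if x: "x \<noteq> 0" and t: "t \<noteq> 0" for x t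
  proof -
    define l where "l = complex_of_real (ln \<bar>t\<bar>)"
    have "cpl (t *\<^sub>R x) = of_real t * cpl x"
      by (simp add: cpl_def complex_eq_iff)
    moreover have "complex_of_real t powi n = of_real (\<bar>t\<bar> powi n)"
      using assms by (cases "t \<ge> 0") (simp_all flip: of_real_power_int)
    moreover have "complex_of_real (\<bar>t\<bar> powi n) = exp l powi n"
      using t by (simp add: l_def exp_of_real)
    ultimately have "cpl (t *\<^sub>R x) powi n = exp (of_int n * l) * cpl x powi n"
      by (simp add: power_int_mult_distrib exp_power_int)
    moreover have "complex_of_real (ln (norm (t *\<^sub>R x))) = l + of_real (ln (norm x))"
      using x t by (simp add: l_def ln_mult)
    moreover have "complex_of_real \<bar>t\<bar> powr (\<tau> - 1) = exp ((\<tau> - 1) * l)"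
      using t by (simp add: powr_def Ln_of_real l_def)
    ultimately show ?thesis
      using x t by (simp add: PS_basis_eq algebra_simps exp_add exp_diff)
  qed
  then show ?thesis
    by (simp add: PS_space_def Cinf_on_PS_basis PS_basis_def[of _ _ 0])
qed

lemma PS_space_add: "f \<in> PS_space \<tau> \<Longrightarrow> g \<in> PS_space \<tau> \<Longrightarrow> (\<lambda>x. f x + g x) \<in> PS_space \<tau>"
  by (auto simp: PS_space_def algebra_simps intro!: Cinf_on_add)

lemma PS_space_cmult: "f \<in> PS_space \<tau> \<Longrightarrow> (\<lambda>x. c * f x) \<in> PS_space \<tau>"
  by (auto simp: PS_space_def algebra_simps intro!: Cinf_on_cmult)

section \<open>The unipotent action on the plane and its vector field\<close>

abbreviation unip :: "real \<Rightarrow> real^2^2" where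
  "unip t \<equiv> mat2 1 t 0 1"

lemma unip_mult: "unip s ** unip t = unip (s + t)"
  by (simp add: mat2_def vec_eq_iff forall_2 matrix_matrix_mult_def sum_2)

lemma unip_0: "unip 0 = mat 1"
  by (simp add: mat2_def vec_eq_iff forall_2 mat_def)

lemma det_unip: "det (unip t) = 1"
  by (simp add: det_2 mat2_def)

lemma unip_in_GL2R: "unip t \<in> GL2R"
  by (simp add: GL2R_def invertible_det_nz det_unip)

lemma matrix_inv_unip: "matrix_inv (unip t) = unip (- t)"
proof -
  have "unip t ** unip (- t) = mat 1 \<and> unip (- t) ** unip t = mat 1"
    by (simp add: unip_mult unip_0)
  then have "matrix_inv (unip t) ** unip t = mat 1"
    unfolding matrix_inv_def by (rule someI2) simp
  then have "matrix_inv (unip t) ** (unip t ** unip (- t)) = unip (- t)"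
    by (simp add: matrix_mul_assoc)
  then show ?thesis by (simp add: unip_mult unip_0)
qed

text \<open>The action of the inverse of \<open>unip t\<close> on column vectors, written as a line
  in \<open>t\<close> so that its velocity is visible.\<close>

definition shear :: "real \<Rightarrow> real^2 \<Rightarrow> real^2" where
  "shear t x = x + t *\<^sub>R vector [- (x $ 2), 0]"

lemma shear_nth [simp]: "shear t x $ 1 = x $ 1 - t * x $ 2" "shear t x $ 2 = x $ 2"
  by (simp_all add: shear_def)

lemma shear_0 [simp]: "shear 0 x = x"
  by (simp add: shear_def)

lemma shear_eq_0_iff [simp]: "shear t x = 0 \<longleftrightarrow> x = 0"
  by (auto simp: vec_eq_iff forall_2)

lemma bounded_linear_shear: "bounded_linear (shear t)"
proof -
  have "linear (shear t)"
    by (rule linearI) (auto simp: vec_eq_iff forall_2 algebra_simps)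
  then show ?thesis using linear_conv_bounded_linear by blast
qed

lemma PS_action_unip: "PS_action \<tau> (unip t) f = (\<lambda>x. f (shear t x))"
proof -
  have "matrix_inv (unip t) *v x = shear t x" for x
    unfolding matrix_inv_unip
    by (simp add: vec_eq_iff forall_2 matrix_vector_mult_def sum_2 mat2_def)
  then show ?thesis by (simp add: PS_action_def det_unip)
qed

lemma Cinf_on_shear:
  assumes "Cinf_on (- {0}) f"
  shows "Cinf_on (- {0}) (\<lambda>x. f (shear t x))"
proof -
  have "shear t -` (- {0}) = - {0}" by auto
  with Cinf_on_compose[OF bounded_linear_shear open_Compl_0 assms, of t] show ?thesis by simp
qed

lemma PS_space_shear: "f \<in> PS_space \<tau> \<Longrightarrow> (\<lambda>x. f (shear t x)) \<in> PS_space \<tau>"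
  by (auto simp: PS_space_def Cinf_on_shear linear_scale[OF bounded_linear.linear[OF bounded_linear_shear]]
      linear_0[OF bounded_linear.linear[OF bounded_linear_shear]])

text \<open>Multiplication by \<open>z\<close> or its conjugate undoes the drop in degree caused by
  a derivative; thus the linear coefficient of the shear vector field leads back to the parameter
  \<open>\<tau>\<close>.\<close>

lemma cpl_times_PS_basis:
  assumes "x \<noteq> 0"
  shows "cpl x * PS_basis (\<tau> - 1) k x = PS_basis \<tau> (k + 1) x"
    and "cnj (cpl x) * PS_basis (\<tau> - 1) k x = PS_basis \<tau> (k - 1) x"
proof -
  let ?l = "complex_of_real (ln (norm x))"
  have z: "cpl x \<noteq> 0" using assms by simp
  show "cpl x * PS_basis (\<tau> - 1) k x = PS_basis \<tau> (k + 1) x"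
    unfolding PS_basis_eq[OF assms] using z by (simp add: power_int_add algebra_simps)
  have "cpl x * cnj (cpl x) = exp ?l * exp ?l"
    using complex_norm_square[of "cpl x"] assms by (simp add: exp_of_real power2_eq_square)
  then have "cnj (cpl x) = exp (2 * ?l) / cpl x"
    using z by (simp add: field_simps exp_add[symmetric])
  moreover have "exp (2 * ?l) * exp ((\<tau> - 1 - 1 - of_int k) * ?l) = exp ((\<tau> - 1 - of_int (k - 1)) * ?l)"
    unfolding exp_add[symmetric] by (rule arg_cong[of _ _ exp]) (simp add: algebra_simps)
  moreover have "cpl x powi (k - 1) = cpl x powi k / cpl x"
    using z by (simp add: power_int_diff)
  ultimately show "cnj (cpl x) * PS_basis (\<tau> - 1) k x = PS_basis \<tau> (k - 1) x"
    unfolding PS_basis_eq[OF assms] by (metis times_divide_eq_left times_divide_eq_right mult.assoc)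
qed

text \<open>The generator \<open>X = - x2 d/dx1\<close> of the shear applied to
  \<open>PS_basis \<tau> n\<close>. Writing \<open>x2 = (z - cnj z) / (2 \<i>)\<close> couples
  \<open>n\<close> with itself and \<open>n \<plusminus> 2\<close>.\<close>

definition PS_shear :: "complex \<Rightarrow> int \<Rightarrow> real^2 \<Rightarrow> complex" where
  "PS_shear \<tau> n x = \<i> / 4 * (2 * of_int n) * PS_basis \<tau> n x
     + (- \<i> / 4 * (\<tau> - 1 + of_int n) * PS_basis \<tau> (n - 2) x
       + \<i> / 4 * (\<tau> - 1 - of_int n) * PS_basis \<tau> (n + 2) x)"

lemma PS_deriv_shear:
  assumes "x \<noteq> 0"
  shows "PS_deriv \<tau> n x (vector [- (x $ 2), 0]) = PS_shear \<tau> n x"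
proof -
  have x2: "complex_of_real (x $ 2) = (cpl x - cnj (cpl x)) / (2 * \<i>)"
    by (simp add: cpl_def complex_eq_iff)
  have v: "cpl (vector [- (x $ 2), 0]) = - of_real (x $ 2)"
    by (simp add: cpl_def complex_eq_iff)
  have "PS_deriv \<tau> n x (vector [- (x $ 2), 0]) = - (1 / (2 * \<i>)) * ((\<tau> - 1 + of_int n) / 2 *
      (cpl x * PS_basis (\<tau> - 1) (n - 1) x - cnj (cpl x) * PS_basis (\<tau> - 1) (n - 1) x)
     + (\<tau> - 1 - of_int n) / 2 *
      (cpl x * PS_basis (\<tau> - 1) (n + 1) x - cnj (cpl x) * PS_basis (\<tau> - 1) (n + 1) x))"
    unfolding PS_deriv_def v complex_cnj_minus complex_cnj_complex_of_real unfolding x2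
    by (simp add: field_simps)
  also have "\<dots> = PS_shear \<tau> n x"
    unfolding cpl_times_PS_basis[OF assms] by (simp add: PS_shear_def field_simps)
  finally show ?thesis .
qed

lemma has_vector_derivative_PS_basis_shear:
  assumes "x \<noteq> 0"
  shows "((\<lambda>t. PS_basis \<tau> n (shear t x)) has_vector_derivative PS_shear \<tau> n (shear t x)) (at t)"
proof -
  have "shear t x \<noteq> 0" using assms by simp
  from PS_basis_has_derivative[OF this]
  have d: "(PS_basis \<tau> n has_derivative PS_deriv \<tau> n (shear t x)) (at (shear t x))" .
  have "((\<lambda>t. shear t x) has_derivative (\<lambda>h. h *\<^sub>R vector [- (x $ 2), 0])) (at t)"
    unfolding shear_def by (auto intro!: derivative_eq_intros)
  from has_derivative_compose[OF this d]
  have "((\<lambda>t. PS_basis \<tau> n (shear t x)) has_derivative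
      (\<lambda>h. PS_deriv \<tau> n (shear t x) (h *\<^sub>R vector [- (x $ 2), 0]))) (at t)" .
  moreover have "PS_deriv \<tau> n (shear t x) (h *\<^sub>R vector [- (x $ 2), 0]) = h *\<^sub>R PS_shear \<tau> n (shear t x)" for h
    using PS_deriv_shear[of "shear t x" \<tau> n] assms
      linear_scale[OF has_derivative_linear[OF d]] by simp
  ultimately show ?thesis by (simp add: has_vector_derivative_def)
qed

lemma Cinf_on_PS_shear: "Cinf_on (- {0}) (PS_shear \<tau> n)"
  unfolding PS_shear_def
  by (intro Cinf_on_add Cinf_on_cmult open_Compl_0 Cinf_on_PS_basis)

lemma PS_shear_in_PS_space: "even n \<Longrightarrow> PS_shear \<tau> n \<in> PS_space \<tau>"
  unfolding PS_shear_def
  by (intro PS_space_add PS_space_cmult PS_basis_in_PS_space) auto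

section \<open>Convergence of the difference quotients with all derivatives\<close>

text \<open>The difference quotient is spelled as a sum with scalar factors, so that the closure
  rules of \<open>PS_space\<close> and the linearity of \<open>\<nu>\<close> apply
  literally.\<close>

definition PS_quot :: "real \<Rightarrow> complex \<Rightarrow> int \<Rightarrow> real^2 \<Rightarrow> complex" where
  "PS_quot s \<tau> n x = of_real (1 / s) * PS_basis \<tau> n (shear s x) + of_real (- (1 / s)) * PS_basis \<tau> n x"

definition PS_err :: "real \<Rightarrow> complex \<Rightarrow> int \<Rightarrow> real^2 \<Rightarrow> complex" where
  "PS_err s \<tau> n x = PS_quot s \<tau> n x + (- 1) * PS_shear \<tau> n x"

lemma PS_quot_in_PS_space: "even n \<Longrightarrow> PS_quot s \<tau> n \<in> PS_space \<tau>"
  unfolding PS_quot_def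
  by (intro PS_space_add PS_space_cmult PS_space_shear PS_basis_in_PS_space)

lemma Cinf_on_PS_quot: "Cinf_on (- {0}) (PS_quot s \<tau> n)"
  unfolding PS_quot_def
  by (intro Cinf_on_add Cinf_on_cmult open_Compl_0 Cinf_on_shear Cinf_on_PS_basis)

lemma Cinf_on_PS_err: "Cinf_on (- {0}) (PS_err s \<tau> n)"
  unfolding PS_err_def
  by (intro Cinf_on_add Cinf_on_cmult open_Compl_0 Cinf_on_PS_quot Cinf_on_PS_shear)

text \<open>With \<open>X = - x2 d/dx1\<close> and \<open>d_v\<close> the derivative along
  \<open>v\<close>, the commutator relation is \<open>d_v X = X d_v - v2 d/dx1\<close>. The terms
  with \<open>v $ 2\<close> come from the commutator.\<close>

lemma PS_shear_has_derivative:
  assumes "x \<noteq> 0"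
  shows "(PS_shear \<tau> n has_derivative (\<lambda>v.
      (\<tau> - 1 + of_int n) / 2 * (cpl v * PS_shear (\<tau> - 1) (n - 1) x - of_real (v $ 2) * PS_basis (\<tau> - 1) (n - 1) x)
    + (\<tau> - 1 - of_int n) / 2 * (cnj (cpl v) * PS_shear (\<tau> - 1) (n + 1) x - of_real (v $ 2) * PS_basis (\<tau> - 1) (n + 1) x)))
    (at x)"
proof -
  have "(PS_shear \<tau> n has_derivative (\<lambda>v. \<i> / 4 * (2 * of_int n) * PS_deriv \<tau> n x v
     + (- \<i> / 4 * (\<tau> - 1 + of_int n) * PS_deriv \<tau> (n - 2) x v
       + \<i> / 4 * (\<tau> - 1 - of_int n) * PS_deriv \<tau> (n + 2) x v))) (at x)"
    unfolding PS_shear_def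
    by (intro has_derivative_add has_derivative_mult_right PS_basis_has_derivative assms)
  moreover have "\<i> / 4 * (2 * of_int n) * PS_deriv \<tau> n x v
     + (- \<i> / 4 * (\<tau> - 1 + of_int n) * PS_deriv \<tau> (n - 2) x v
       + \<i> / 4 * (\<tau> - 1 - of_int n) * PS_deriv \<tau> (n + 2) x v)
     = (\<tau> - 1 + of_int n) / 2 * (cpl v * PS_shear (\<tau> - 1) (n - 1) x - of_real (v $ 2) * PS_basis (\<tau> - 1) (n - 1) x)
    + (\<tau> - 1 - of_int n) / 2 * (cnj (cpl v) * PS_shear (\<tau> - 1) (n + 1) x - of_real (v $ 2) * PS_basis (\<tau> - 1) (n + 1) x)"
    for v
  proof -
    have v: "complex_of_real (v $ 2) = - \<i> / 2 * (cpl v - cnj (cpl v))"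
      by (simp add: cpl_def complex_eq_iff)
    have i: "n - 2 - 1 = n - 3" "n - 2 + 1 = n - 1" "n + 2 - 1 = n + 1" "n + 2 + 1 = n + 3"
      "n - 1 - 2 = n - 3" "n - 1 + 2 = n + 1" "n + 1 - 2 = n - 1" "n + 1 + 2 = n + 3" by simp_all
    define N where "N = (of_int n :: complex)"
    define T where "T = \<tau> - 1"
    have c: "of_int (n - 2) = N - 2" "of_int (n + 2) = N + 2" "of_int (n - 1) = N - 1" "of_int (n + 1) = N + 1"
      by (simp_all add: N_def)
    show ?thesis
      unfolding v PS_deriv_def PS_shear_def i c N_def[symmetric] T_def[symmetric]
      by (simp add: field_simps)
  qed
  ultimately show ?thesis by simp
qed

text \<open>The errors are closed under differentiation up to terms with a factor \<open>s\<close>.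
  Replacing \<open>cpl v\<close> by \<open>cpl (shear s v)\<close> contributes \<open>- v2\<close>
  times a sheared basis vector; the commutator term completes it to \<open>- s * v2\<close> times a
  difference quotient, which is an error plus a \<open>PS_shear\<close>.\<close>

lemma PS_err_deriv:
  assumes "x \<noteq> 0" "s \<noteq> 0"
  shows "iter_deriv [v] (PS_err s \<tau> n) x =
      ((\<tau> - 1 + of_int n) / 2 * (cpl v - of_real (s * v $ 2)) * PS_err s (\<tau> - 1) (n - 1) x
       + (\<tau> - 1 + of_int n) / 2 * of_real (- (s * v $ 2)) * PS_shear (\<tau> - 1) (n - 1) x)
    + ((\<tau> - 1 - of_int n) / 2 * (cnj (cpl v) - of_real (s * v $ 2)) * PS_err s (\<tau> - 1) (n + 1) x
       + (\<tau> - 1 - of_int n) / 2 * of_real (- (s * v $ 2)) * PS_shear (\<tau> - 1) (n + 1) x)"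
proof -
  have x: "shear s x \<noteq> 0" using assms by simp
  have "((\<lambda>x. PS_basis \<tau> n (shear s x)) has_derivative (\<lambda>v. PS_deriv \<tau> n (shear s x) (shear s v))) (at x)"
    by (rule has_derivative_compose[OF bounded_linear_imp_has_derivative[OF bounded_linear_shear]
        PS_basis_has_derivative[OF x]])
  then have "(PS_err s \<tau> n has_derivative (\<lambda>v. of_real (1 / s) * PS_deriv \<tau> n (shear s x) (shear s v)
      + of_real (- (1 / s)) * PS_deriv \<tau> n x v + (- 1) * 
      ((\<tau> - 1 + of_int n) / 2 * (cpl v * PS_shear (\<tau> - 1) (n - 1) x - of_real (v $ 2) * PS_basis (\<tau> - 1) (n - 1) x)
    + (\<tau> - 1 - of_int n) / 2 * (cnj (cpl v) * PS_shear (\<tau> - 1) (n + 1) x - of_real (v $ 2) * PS_basis (\<tau> - 1) (n + 1) x)))) (at x)"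
    unfolding PS_err_def PS_quot_def
    by (intro has_derivative_add has_derivative_mult_right PS_basis_has_derivative PS_shear_has_derivative assms)
  from frechet_derivative_at[OF this]
  have "iter_deriv [v] (PS_err s \<tau> n) x = of_real (1 / s) * PS_deriv \<tau> n (shear s x) (shear s v)
      + of_real (- (1 / s)) * PS_deriv \<tau> n x v + (- 1) * 
      ((\<tau> - 1 + of_int n) / 2 * (cpl v * PS_shear (\<tau> - 1) (n - 1) x - of_real (v $ 2) * PS_basis (\<tau> - 1) (n - 1) x)
    + (\<tau> - 1 - of_int n) / 2 * (cnj (cpl v) * PS_shear (\<tau> - 1) (n + 1) x - of_real (v $ 2) * PS_basis (\<tau> - 1) (n + 1) x))"
    by (simp add: fun_eq_iff)
  moreover have "cpl (shear s v) = cpl v - of_real (s * v $ 2)"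
    by (simp add: cpl_def complex_eq_iff)
  ultimately show ?thesis
    using assms(2) by (simp add: PS_deriv_def PS_err_def PS_quot_def) (simp add: field_simps)
qed

text \<open>Mean value inequality in the shear parameter: the auxiliary function \<open>?g\<close>
  has derivative \<open>PS_shear \<tau> n (shear t x) - PS_shear \<tau> n x\<close>, which is small
  uniformly in \<open>x\<close> by uniform continuity on the compact set
  \<open>{-1..1} \<times> C\<close>.\<close>

lemma PS_err_uniform_limit:
  assumes C: "compact C" "C \<subseteq> - {0}"
  shows "uniform_limit C (\<lambda>s. PS_err s \<tau> n) (\<lambda>x. 0) (at 0)"
proof (rule uniform_limitI)
  fix e :: real assume e: "e > 0"
  let ?h = "\<lambda>(t, x). PS_shear \<tau> n (shear t x)"
  have c1: "continuous_on ({-1..1} \<times> C) (\<lambda>p. shear (fst p) (snd p))"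
    unfolding shear_def
  proof (intro continuous_intros)
    have "bounded_linear (\<lambda>y::real. vector [- y, 0] :: real^2)"
    proof -
      have "linear (\<lambda>y::real. vector [- y, 0] :: real^2)"
        by (rule linearI) (auto simp: vec_eq_iff forall_2)
      then show ?thesis using linear_conv_bounded_linear by blast
    qed
    then show "continuous_on ({-1..1} \<times> C) (\<lambda>p. vector [- (snd p $ 2), 0] :: real^2)"
      by (rule bounded_linear.continuous_on) (intro continuous_intros)
  qed
  have c2: "continuous_on (- {0}) (PS_shear \<tau> n)"
    using Cinf_on_imp_continuous_on[OF Cinf_on_PS_shear, of "[]"] by simp
  have "continuous_on ({-1..1} \<times> C) (\<lambda>p. PS_shear \<tau> n (shear (fst p) (snd p)))"
    by (rule continuous_on_compose2[OF c2 c1]) (use C(2) in auto)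
  then have "uniformly_continuous_on ({-1..1} \<times> C) (\<lambda>p. PS_shear \<tau> n (shear (fst p) (snd p)))"
    by (rule compact_uniformly_continuous) (intro compact_Times C compact_Icc)
  then obtain d where d: "d > 0" "\<And>p q. p \<in> {-1..1} \<times> C \<Longrightarrow> q \<in> {-1..1} \<times> C \<Longrightarrow> dist q p < d \<Longrightarrow>
      dist (PS_shear \<tau> n (shear (fst q) (snd q))) (PS_shear \<tau> n (shear (fst p) (snd p))) < e / 2"
    using e unfolding uniformly_continuous_on_def by (metis half_gt_zero)
  define r where "r = min d 1"
  have r: "r > 0" "r \<le> d" "r \<le> 1" using d by (auto simp: r_def)
  have "dist (PS_err s \<tau> n x) 0 < e" if s: "s \<noteq> 0" "\<bar>s\<bar> < r" and x: "x \<in> C" for s x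
  proof -
    have x0: "x \<noteq> 0" using x C(2) by auto
    let ?g = "\<lambda>t. PS_basis \<tau> n (shear t x) - t *\<^sub>R PS_shear \<tau> n x"
    let ?I = "{min 0 s..max 0 s}"
    have "norm (?g s - ?g 0) \<le> e / 2 * norm (s - 0)"
    proof (rule differentiable_bound)
      show "(?g has_derivative (\<lambda>h. h *\<^sub>R (PS_shear \<tau> n (shear t x) - PS_shear \<tau> n x))) (at t within ?I)"
        if "t \<in> ?I" for t
        using has_vector_derivative_PS_basis_shear[OF x0, of \<tau> n t]
        unfolding has_vector_derivative_def scaleR_diff_right
        by (intro has_derivative_diff has_derivative_at_withinI[of ?g] has_derivative_scaleR_left)
          (auto intro: has_derivative_at_withinI)
      show "onorm (\<lambda>h. h *\<^sub>R (PS_shear \<tau> n (shear t x) - PS_shear \<tau> n x)) \<le> e / 2" if t: "t \<in> ?I" for t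
      proof (rule onorm_le)
        have "\<bar>t\<bar> < r" using t s by auto
        then have "dist (t, x) (0, x) < d" "t \<in> {-1..1}"
          using r by (auto simp: dist_Pair_Pair)
        then have "norm (PS_shear \<tau> n (shear t x) - PS_shear \<tau> n x) \<le> e / 2"
          using d(2)[of "(0, x)" "(t, x)"] x by (simp add: dist_norm)
        then show "norm (h *\<^sub>R (PS_shear \<tau> n (shear t x) - PS_shear \<tau> n x)) \<le> e / 2 * norm h" for h
          unfolding norm_scaleR real_norm_def mult.commute[of "\<bar>h\<bar>"] by (rule mult_right_mono) simp
      qed
    qed (auto simp: is_interval_convex)
    moreover have "?g s - ?g 0 = of_real s * PS_err s \<tau> n x"
      using s by (simp add: PS_err_def PS_quot_def scaleR_conv_of_real field_simps)
    ultimately have "\<bar>s\<bar> * norm (PS_err s \<tau> n x) \<le> e / 2 * \<bar>s\<bar>"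
      by (simp add: norm_mult)
    then show ?thesis using s e by (simp add: mult.commute)
  qed
  then show "\<forall>\<^sub>F s in at 0. \<forall>x\<in>C. dist (PS_err s \<tau> n x) 0 < e"
    unfolding eventually_at using r(1) by (intro exI[of _ r]) auto
qed

text \<open>By \<open>PS_err_deriv\<close>, derivatives of an error reduce to shorter derivatives of
  errors with other parameters, which vanish in the limit by induction, and to functions bounded on
  \<open>C\<close> multiplied by \<open>s\<close>.\<close>

lemma iter_deriv_PS_err_uniform_limit:
  assumes C: "compact C" "C \<subseteq> - {0}"
  shows "uniform_limit C (\<lambda>s. iter_deriv vs (PS_err s \<tau> n)) (\<lambda>x. 0) (at 0)"
proof (induction vs arbitrary: \<tau> n rule: rev_induct)
  case Nil
  show ?case using PS_err_uniform_limit[OF C] by simp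
next
  case (snoc v vs)
  define a where "a = (\<tau> - 1 + of_int n) / 2"
  define b where "b = (\<tau> - 1 - of_int n) / 2"
  have bd: "bounded (iter_deriv vs (PS_shear \<tau>' n') ` C)" for \<tau>' n'
    by (intro compact_imp_bounded compact_continuous_image C
        continuous_on_subset[OF Cinf_on_imp_continuous_on[OF Cinf_on_PS_shear]])
  have const: "uniform_limit C (\<lambda>s x. f s) (\<lambda>x. l) (at 0)" if "(f \<longlongrightarrow> l) (at 0)" for f :: "real \<Rightarrow> complex" and l
    using that by (auto intro!: uniform_limitI dest!: tendstoD elim: eventually_mono)
  have t0: "((\<lambda>s. k * (z - of_real (s * v $ 2))) \<longlongrightarrow> k * (z - of_real (0 * v $ 2))) (at (0::real))" for k z :: complex
    by (intro tendsto_intros)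
  have t1: "((\<lambda>s. k * of_real (- (s * v $ 2))) \<longlongrightarrow> k * of_real (- (0 * v $ 2))) (at (0::real))" for k :: complex
    by (intro tendsto_intros)
  have e1: "uniform_limit C (\<lambda>s x. k * (z - of_real (s * v $ 2)) * iter_deriv vs (PS_err s (\<tau> - 1) n') x)
      (\<lambda>x. k * (z - of_real (0 * v $ 2)) * 0) (at 0)" for k z n'
    by (intro uniform_lim_mult const t0 snoc) (auto simp: image_constant_conv)
  have e2: "uniform_limit C (\<lambda>s x. k * of_real (- (s * v $ 2)) * iter_deriv vs (PS_shear (\<tau> - 1) n') x)
      (\<lambda>x. k * of_real (- (0 * v $ 2)) * iter_deriv vs (PS_shear (\<tau> - 1) n') x) (at 0)" for k n'
    by (intro uniform_lim_mult const t1 bd uniform_limit_const) (auto simp: image_constant_conv)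
  let ?R = "\<lambda>s x. (a * (cpl v - of_real (s * v $ 2)) * iter_deriv vs (PS_err s (\<tau> - 1) (n - 1)) x
       + a * of_real (- (s * v $ 2)) * iter_deriv vs (PS_shear (\<tau> - 1) (n - 1)) x)
    + (b * (cnj (cpl v) - of_real (s * v $ 2)) * iter_deriv vs (PS_err s (\<tau> - 1) (n + 1)) x
       + b * of_real (- (s * v $ 2)) * iter_deriv vs (PS_shear (\<tau> - 1) (n + 1)) x)"
  have "uniform_limit C ?R (\<lambda>x. (a * (cpl v - of_real (0 * v $ 2)) * 0
       + a * of_real (- (0 * v $ 2)) * iter_deriv vs (PS_shear (\<tau> - 1) (n - 1)) x)
    + (b * (cnj (cpl v) - of_real (0 * v $ 2)) * 0
       + b * of_real (- (0 * v $ 2)) * iter_deriv vs (PS_shear (\<tau> - 1) (n + 1)) x)) (at 0)"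
    by (intro uniform_limit_add e1 e2)
  then have lim: "uniform_limit C ?R (\<lambda>x. 0) (at 0)" by simp
  have eq: "iter_deriv (vs @ [v]) (PS_err s \<tau> n) x = ?R s x" if s: "s \<noteq> 0" and x: "x \<in> C" for s x
  proof -
    have x0: "x \<in> - {0}" using C(2) x by auto
    have "iter_deriv (vs @ [v]) (PS_err s \<tau> n) x = iter_deriv vs (\<lambda>x.
      (a * (cpl v - of_real (s * v $ 2)) * PS_err s (\<tau> - 1) (n - 1) x
       + a * of_real (- (s * v $ 2)) * PS_shear (\<tau> - 1) (n - 1) x)
    + (b * (cnj (cpl v) - of_real (s * v $ 2)) * PS_err s (\<tau> - 1) (n + 1) x
       + b * of_real (- (s * v $ 2)) * PS_shear (\<tau> - 1) (n + 1) x)) x"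
      unfolding iter_deriv_append a_def b_def
      by (rule iter_deriv_cong[OF open_Compl_0 PS_err_deriv x0]) (use s in auto)
    also have "\<dots> = ?R s x"
      using x0 by (simp only: iter_deriv_add[OF open_Compl_0] iter_deriv_cmult[OF open_Compl_0]
          Cinf_on_add[OF open_Compl_0] Cinf_on_cmult[OF open_Compl_0] Cinf_on_PS_err Cinf_on_PS_shear)
    finally show ?thesis .
  qed
  show ?case
    by (rule uniform_limit_cong[THEN iffD2, OF _ _ lim])
      (auto simp: eq eventually_at intro!: exI[of _ 1])
qed

text \<open>Passes to sequences, the form in which continuity of an embedding is available.\<close>

lemma PS_quot_converges:
  assumes "filterlim s (at 0) sequentially"
  shows "Cinf_converges (- {0}) (\<lambda>j. PS_quot (s j) \<tau> n) (PS_shear \<tau> n)"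
  unfolding Cinf_converges_def
proof (intro allI impI)
  fix vs and C :: "(real^2) set" assume C: "compact C \<and> C \<subseteq> - {0}"
  have "uniform_limit C (\<lambda>j. iter_deriv vs (PS_err (s j) \<tau> n)) (\<lambda>x. 0) sequentially"
    using C by (intro filterlim_compose[OF iter_deriv_PS_err_uniform_limit assms]) auto
  from uniform_limit_add[OF this uniform_limit_const[where c = "iter_deriv vs (PS_shear \<tau> n)"]]
  have lim: "uniform_limit C (\<lambda>j x. iter_deriv vs (PS_err (s j) \<tau> n) x + iter_deriv vs (PS_shear \<tau> n) x)
      (\<lambda>x. iter_deriv vs (PS_shear \<tau> n) x) sequentially" by simp
  have "iter_deriv vs (PS_err r \<tau> n) x = iter_deriv vs (PS_quot r \<tau> n) x + (- 1) * iter_deriv vs (PS_shear \<tau> n) x"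
    if "x \<in> C" for x r
  proof -
    have "x \<in> - {0}" using C that by auto
    then show ?thesis unfolding PS_err_def
      by (simp only: iter_deriv_add[OF open_Compl_0] iter_deriv_cmult[OF open_Compl_0]
          Cinf_on_cmult[OF open_Compl_0] Cinf_on_PS_quot Cinf_on_PS_shear)
  qed
  then show "uniform_limit C (\<lambda>j. iter_deriv vs (PS_quot (s j) \<tau> n)) (iter_deriv vs (PS_shear \<tau> n)) sequentially"
    using uniform_limit_cong[THEN iffD2, OF _ _ lim] by auto
qed

section \<open>Zero-mean primitives along the unipotent flow\<close>

text \<open>Collects what survives the passage to a zero-mean primitive. The order \<open>M\<close>
  is a parameter because it must stay the same at every step.\<close>

definition shear_flow :: "complex \<Rightarrow> real \<Rightarrow> (int \<Rightarrow> real \<Rightarrow> complex) \<Rightarrow> bool" where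
  "shear_flow \<mu> M A \<longleftrightarrow>
     (\<forall>m. \<forall>t\<in>{0..1}. (A m has_vector_derivative shear_op \<mu> (\<lambda>m. A m t) m) (at t within {0..1}))
     \<and> (\<forall>m. (A m has_integral 0) {0..1})
     \<and> (\<exists>C. \<forall>m. \<forall>t\<in>{0..1}. norm (A m t) \<le> C * (1 + real_of_int \<bar>m\<bar>) powr M)"

text \<open>Let \<open>B\<close> be the primitive of \<open>A\<close> minus its mean. Since
  \<open>T\<close> involves only three neighbours it commutes with \<open>d/dt\<close>, so
  \<open>T B\<close> and \<open>A\<close> have the same derivative \<open>T A\<close>. Their
  difference is constant in \<open>t\<close> and has mean zero, hence vanishes. Integration over a
  unit interval at most doubles the constant \<open>C\<close>.\<close>

lemma shear_flow_primitive:
  assumes "shear_flow \<mu> M A"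
  shows "\<exists>B. shear_flow \<mu> M B \<and> (\<forall>m. \<forall>t\<in>{0..1}. shear_op \<mu> (\<lambda>m. B m t) m = A m t)"
proof -
  have D: "\<And>m t. t \<in> {0..1} \<Longrightarrow> (A m has_vector_derivative shear_op \<mu> (\<lambda>m. A m t) m) (at t within {0..1})"
    and Z: "\<And>m. (A m has_integral 0) {0..1}"
    using assms unfolding shear_flow_def by blast+
  obtain C where C: "\<And>m t. t \<in> {0..1} \<Longrightarrow> norm (A m t) \<le> C * (1 + real_of_int \<bar>m\<bar>) powr M"
    using assms unfolding shear_flow_def by blast
  have contA: "continuous_on {0..1} (A m)" for m
    by (rule continuous_on_vector_derivative[OF D])
  define P where "P m t = integral {0..t} (A m)" for m t
  have dP: "(P m has_vector_derivative A m t) (at t within {0..1})" if "t \<in> {0..1}" for m t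
    unfolding P_def by (rule integral_has_vector_derivative[OF contA that])
  have contP: "continuous_on {0..1} (P m)" for m
    by (rule continuous_on_vector_derivative[OF dP])
  define I where "I m = integral {0..1} (P m)" for m
  have I: "(P m has_integral I m) {0..1}" for m
    unfolding I_def by (intro integrable_integral integrable_continuous_real contP)
  define B where "B m t = P m t - I m" for m t
  have dB: "(B m has_vector_derivative A m t) (at t within {0..1})" if "t \<in> {0..1}" for m t
    unfolding B_def using has_vector_derivative_diff[OF dP[OF that] has_vector_derivative_const] by simp
  have ZB: "(B m has_integral 0) {0..1}" for m
    unfolding B_def using has_integral_diff[OF I[of m] has_integral_const_real[of "I m" 0 1]] by simp
  have op: "shear_op \<mu> (\<lambda>m. B m t) m = A m t" if t: "t \<in> {0..1}" for m t
  proof -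
    let ?E = "\<lambda>t. shear_op \<mu> (\<lambda>m. B m t) m - A m t"
    have "(?E has_vector_derivative 0) (at t within {0..1})" if "t \<in> {0..1}" for t
    proof -
      have "((\<lambda>t. shear_op \<mu> (\<lambda>m. B m t) m) has_vector_derivative shear_op \<mu> (\<lambda>m. A m t) m) (at t within {0..1})"
        unfolding shear_op_def
        by (intro has_vector_derivative_mult_right has_vector_derivative_diff dB that)
      from has_vector_derivative_diff[OF this D[OF that, of m]] show ?thesis by simp
    qed
    then obtain c where c: "\<And>t. t \<in> {0..1} \<Longrightarrow> ?E t = c"
      using has_vector_derivative_zero_constant[of "{0..1}" ?E] by auto
    have "((\<lambda>t. shear_op \<mu> (\<lambda>m. B m t) m) has_integral
        \<i> / 2 * (2 * of_int m * 0 - (of_int m + \<mu>) * 0 - (of_int m - \<mu>) * 0)) {0..1}"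
      unfolding shear_op_def by (intro has_integral_mult_right has_integral_diff ZB)
    from has_integral_diff[OF this Z[of m]]
    have "(?E has_integral 0) {0..1}" by simp
    moreover have "(?E has_integral c) {0..1}"
      by (rule has_integral_eq[where f = "\<lambda>_. c"]) (use c has_integral_const_real[of c 0 1] in auto)
    ultimately have "c = 0" by (metis has_integral_unique)
    with c[OF t] show ?thesis by simp
  qed
  have "norm (B m t) \<le> 2 * C * (1 + real_of_int \<bar>m\<bar>) powr M" if t: "t \<in> {0..1}" for m t
  proof -
    define K where "K = C * (1 + real_of_int \<bar>m\<bar>) powr M"
    have K: "K \<ge> 0" using order_trans[OF norm_ge_zero C[of 0 m]] by (simp add: K_def)
    have P: "norm (P m s) \<le> K" if s: "s \<in> {0..1}" for s
    proof -
      have "norm (P m s) \<le> K * (s - 0)"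
        unfolding P_def using s C K
        by (intro integral_bound continuous_on_subset[OF contA]) (auto simp: K_def)
      also have "\<dots> \<le> K" using s K by (simp add: mult_left_le)
      finally show ?thesis .
    qed
    have "norm (I m) \<le> K * (1 - 0)"
      unfolding I_def using P by (intro integral_bound contP) auto
    with P[OF t] show ?thesis
      unfolding B_def using norm_triangle_ineq4[of "P m t" "I m"] by (simp add: K_def)
  qed
  then have "\<exists>C. \<forall>m. \<forall>t\<in>{0..1}. norm (B m t) \<le> C * (1 + real_of_int \<bar>m\<bar>) powr M"
    by blast
  with dB ZB op have "shear_flow \<mu> M B"
    unfolding shear_flow_def by simp
  with op show ?thesis by blast
qed

text \<open>Dependent choice iterates \<open>shear_flow_primitive\<close> from
  \<open>B 0 = A\<close>; evaluation at \<open>t = 0\<close> gives the tower that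
  \<open>entire_continuation\<close> consumes.\<close>

lemma shear_flow_entire_continuation:
  assumes "shear_flow \<mu> M A"
  shows "\<exists>F. F holomorphic_on UNIV \<and> (\<forall>w. Re w > M + 2 \<longrightarrow>
    (\<lambda>m. A m 0 * abs_powr_symbol w m) summable_on UNIV \<and>
    F w = (\<Sum>\<^sub>\<infinity>m. A m 0 * abs_powr_symbol w m))"
proof -
  have "\<exists>B. \<forall>k. (shear_flow \<mu> M (B k) \<and> (k = 0 \<longrightarrow> B k = A)) \<and>
      (\<forall>m. \<forall>t\<in>{0..1}. shear_op \<mu> (\<lambda>m. B (Suc k) m t) m = B k m t)"
    by (rule dependent_nat_choice) (use assms shear_flow_primitive in blast)+
  then obtain B where B: "\<And>k. shear_flow \<mu> M (B k)" "B 0 = A"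
    "\<And>k m t. t \<in> {0..1} \<Longrightarrow> shear_op \<mu> (\<lambda>m. B (Suc k) m t) m = B k m t"
    by blast
  have "\<exists>C. \<forall>m. norm (B k m 0) \<le> C * (1 + real_of_int \<bar>m\<bar>) powr M" for k
    using B(1)[of k] unfolding shear_flow_def by (meson atLeastAtMost_iff order_refl zero_le_one)
  then obtain F where "F holomorphic_on UNIV"
    "\<And>w. Re w > M + 2 \<Longrightarrow> (\<lambda>m. B 0 m 0 * abs_powr_symbol w m) summable_on UNIV"
    "\<And>w. Re w > M + 2 \<Longrightarrow> F w = (\<Sum>\<^sub>\<infinity>m. B 0 m 0 * abs_powr_symbol w m)"
    using entire_continuation[of \<mu> "\<lambda>k m. B k m 0" M] B(3) by auto
  then show ?thesis unfolding B(2) by blast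
qed

section \<open>The coefficients of an embedding\<close>

lemma PS_embeddingD:
  assumes "PS_embedding \<tau> \<nu>"
  shows "f \<in> PS_space \<tau> \<Longrightarrow> \<nu> f \<in> Cinf_Gamma_G"
    and "f \<in> PS_space \<tau> \<Longrightarrow> h \<in> PS_space \<tau> \<Longrightarrow> \<nu> (\<lambda>x. f x + h x) = (\<lambda>g. \<nu> f g + \<nu> h g)"
    and "f \<in> PS_space \<tau> \<Longrightarrow> \<nu> (\<lambda>x. z * f x) = (\<lambda>g. z * \<nu> f g)"
    and "(\<And>j. H j \<in> PS_space \<tau>) \<Longrightarrow> f \<in> PS_space \<tau> \<Longrightarrow> Cinf_converges (- {0}) H f \<Longrightarrow>
           Cinf_converges GL2R (\<lambda>j. \<nu> (H j)) (\<nu> f)"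
    and "f \<in> PS_space \<tau> \<Longrightarrow> a \<in> GL2R \<Longrightarrow> b \<in> GL2R \<Longrightarrow> \<nu> (PS_action \<tau> a f) b = \<nu> f (b ** a)"
  using assms unfolding PS_embedding_def by blast+

lemma Cinf_convergesD:
  assumes "Cinf_converges S H f" "compact C" "C \<subseteq> S"
  shows "uniform_limit C H f sequentially"
  using assms(1)[unfolded Cinf_converges_def, rule_format, of C "[]"] assms(2,3) by simp

lemma continuous_on_unip_mult: "continuous_on S (\<lambda>t. unip t ** g)"
proof -
  have "unip 0 ** g + t *\<^sub>R (mat2 0 1 0 0 ** g) = unip t ** g" for t
    by (simp add: mat2_def vec_eq_iff forall_2 matrix_matrix_mult_def sum_2 algebra_simps)
  moreover have "continuous_on S (\<lambda>t. unip 0 ** g + t *\<^sub>R (mat2 0 1 0 0 ** g))"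
    by (intro continuous_intros)
  ultimately show ?thesis by (simp only:)
qed

lemma continuous_on_unip: "continuous_on S unip"
  using continuous_on_unip_mult[of S "mat 1"] by simp

lemma PS_embedding_growth:
  assumes emb: "PS_embedding \<tau> \<nu>"
  shows "\<exists>M C. \<forall>m. \<forall>t\<in>{0..1}. norm (\<nu> (PS_basis \<tau> (2 * m)) (unip t)) \<le> C * (1 + real_of_int \<bar>m\<bar>) powr M"
proof (rule ccontr)
  assume neg: "\<not> ?thesis"
  \<comment> \<open>The same \<open>j\<close> governs the constant and the exponent, so one sequence
    defeats every derivative order and leaves a factor tending to 0.\<close>
  have "\<exists>m t. t \<in> {0..1} \<and> norm (\<nu> (PS_basis \<tau> (2 * m)) (unip t)) > real (Suc j) * (1 + real_of_int \<bar>m\<bar>) ^ j" for j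
  proof (rule ccontr)
    assume "\<not> ?thesis"
    then have "\<forall>m. \<forall>t\<in>{0..1}. norm (\<nu> (PS_basis \<tau> (2 * m)) (unip t)) \<le> real (Suc j) * (1 + real_of_int \<bar>m\<bar>) powr real j"
      by (auto simp: powr_realpow not_less)
    with neg show False by blast
  qed
  then obtain m t where t: "\<And>j. t j \<in> {0..1}"
    and big: "\<And>j. norm (\<nu> (PS_basis \<tau> (2 * m j)) (unip (t j))) > real (Suc j) * (1 + real_of_int \<bar>m j\<bar>) ^ j"
    by metis
  define c where "c j = 1 / (real (Suc j) * (1 + real_of_int \<bar>m j\<bar>) ^ j)" for j
  have c_nonneg: "c j \<ge> 0" for j by (simp add: c_def)
  define H where "H j x = complex_of_real (c j) * PS_basis \<tau> (2 * m j) x" for j x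
  have H: "H j \<in> PS_space \<tau>" for j
    unfolding H_def by (intro PS_space_cmult PS_basis_in_PS_space) simp
  \<comment> \<open>The zero function as a multiple of a basis vector, so that the scalar rules give
    both its membership and the vanishing of its image.\<close>
  let ?z = "\<lambda>x. 0 * PS_basis \<tau> 0 x"
  have z: "?z \<in> PS_space \<tau>" by (intro PS_space_cmult PS_basis_in_PS_space) simp
  have "Cinf_converges (- {0}) H ?z"
    unfolding Cinf_converges_def
  proof (intro allI impI uniform_limitI)
    fix vs :: "(real^2) list" and C and e :: real assume C: "compact C \<and> C \<subseteq> - {0 :: real^2}" and e: "e > 0"
    let ?k = "length vs"
    obtain K where K: "K \<ge> 0" "\<And>n x. x \<in> C \<Longrightarrow>
        norm (iter_deriv vs (PS_basis \<tau> n) x) \<le> K * (1 + real_of_int \<bar>n\<bar>) ^ ?k"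
      using iter_deriv_PS_basis_bound[of C vs \<tau>] C by blast
    have "(\<lambda>j. K * 2 ^ ?k / real (Suc j)) \<longlonglongrightarrow> 0"
      by (rule LIMSEQ_Suc[OF lim_const_over_n])
    then have "\<forall>\<^sub>F j in sequentially. K * 2 ^ ?k / real (Suc j) < e"
      using e by (rule order_tendstoD)
    then show "\<forall>\<^sub>F j in sequentially. \<forall>x\<in>C. dist (iter_deriv vs (H j) x) (iter_deriv vs ?z x) < e"
      using eventually_ge_at_top[of ?k]
    proof eventually_elim
      case (elim j)
      show ?case
      proof
        fix x assume x: "x \<in> C"
        then have x0: "x \<in> - {0}" using C by auto
        define N where "N = 1 + real_of_int \<bar>m j\<bar>"
        have N: "N \<ge> 1" by (simp add: N_def)
        have "iter_deriv vs (H j) x = of_real (c j) * iter_deriv vs (PS_basis \<tau> (2 * m j)) x"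
          unfolding H_def by (rule iter_deriv_cmult[OF open_Compl_0 Cinf_on_PS_basis x0])
        moreover have "iter_deriv vs ?z x = 0 * iter_deriv vs (PS_basis \<tau> 0) x"
          by (rule iter_deriv_cmult[OF open_Compl_0 Cinf_on_PS_basis x0])
        ultimately have "dist (iter_deriv vs (H j) x) (iter_deriv vs ?z x)
            = c j * norm (iter_deriv vs (PS_basis \<tau> (2 * m j)) x)"
          using c_nonneg[of j]
          by (simp only: dist_norm norm_mult norm_of_real mult_zero_left diff_0_right abs_of_nonneg)
        also have "\<dots> \<le> c j * (K * (2 * N) ^ ?k)"
        proof (intro mult_left_mono)
          have "norm (iter_deriv vs (PS_basis \<tau> (2 * m j)) x) \<le> K * (1 + real_of_int \<bar>2 * m j\<bar>) ^ ?k"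
            by (rule K(2)[OF x])
          also have "\<dots> \<le> K * (2 * N) ^ ?k"
            using K(1) by (intro mult_left_mono power_mono) (auto simp: N_def abs_mult)
          finally show "norm (iter_deriv vs (PS_basis \<tau> (2 * m j)) x) \<le> K * (2 * N) ^ ?k" .
        qed (simp add: c_def)
        \<comment> \<open>Once \<open>j\<close> is at least the number \<open>?k\<close> of
          derivatives, \<open>N ^ ?k \<le> N ^ j\<close>, which \<open>c j\<close> cancels down to
          \<open>1 / (j + 1)\<close>.\<close>
        also have "\<dots> \<le> c j * (K * 2 ^ ?k * N ^ j)"
          using N elim(2) K(1)
          by (intro mult_left_mono) (auto simp: c_def power_mult_distrib mult.assoc intro!: mult_left_mono power_increasing)
        also have "\<dots> = K * 2 ^ ?k / real (Suc j)"
          unfolding c_def N_def[symmetric] using N by (simp del: of_nat_Suc)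
        finally show "dist (iter_deriv vs (H j) x) (iter_deriv vs ?z x) < e"
          using elim(1) by linarith
      qed
    qed
  qed
  from PS_embeddingD(4)[OF emb H z this]
  have "uniform_limit (unip ` {0..1}) (\<lambda>j. \<nu> (H j)) (\<nu> ?z) sequentially"
    by (rule Cinf_convergesD)
      (auto simp: unip_in_GL2R intro!: compact_continuous_image continuous_on_unip)
  from uniform_limitD[OF this, of 1]
  obtain j where j: "\<forall>g\<in>unip ` {0..1}. dist (\<nu> (H j) g) (\<nu> ?z g) < 1"
    using eventually_happens by fastforce
  have "\<nu> ?z = (\<lambda>g. 0 * \<nu> (PS_basis \<tau> 0) g)"
    by (rule PS_embeddingD(3)[OF emb]) (simp add: PS_basis_in_PS_space)
  moreover have "\<nu> (H j) = (\<lambda>g. of_real (c j) * \<nu> (PS_basis \<tau> (2 * m j)) g)"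
    unfolding H_def by (rule PS_embeddingD(3)[OF emb]) (simp add: PS_basis_in_PS_space)
  moreover have "dist (\<nu> (H j) (unip (t j))) (\<nu> ?z (unip (t j))) < 1"
    using j t[of j] by blast
  ultimately have "c j * norm (\<nu> (PS_basis \<tau> (2 * m j)) (unip (t j))) < 1"
    using c_nonneg[of j]
    by (simp only: dist_norm norm_mult norm_of_real mult_zero_left diff_0_right abs_of_nonneg)
  moreover have "real (Suc j) * (1 + real_of_int \<bar>m j\<bar>) ^ j > 0"
    by (intro mult_pos_pos zero_less_power) auto
  ultimately show False
    using big[of j] by (simp add: c_def divide_less_eq del: of_nat_Suc)
qed

text \<open>For \<open>n = 2 * m\<close> the coefficients
  \<open>(\<tau> - 1 \<plusminus> n) / 4\<close> become \<open>(\<mu> \<plusminus> m) / 2\<close>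
  with \<open>\<mu> = (\<tau> - 1) / 2\<close>.\<close>

lemma PS_embedding_shear:
  assumes emb: "PS_embedding \<tau> \<nu>"
  shows "\<nu> (PS_shear \<tau> (2 * m)) g = shear_op ((\<tau> - 1) / 2) (\<lambda>m. \<nu> (PS_basis \<tau> (2 * m)) g) m"
proof -
  have e: "PS_basis \<tau> (2 * m) \<in> PS_space \<tau>" for m
    by (simp add: PS_basis_in_PS_space)
  have i: "2 * m - 2 = 2 * (m - 1)" "2 * m + 2 = 2 * (m + 1)" by simp_all
  have "\<nu> (PS_shear \<tau> (2 * m)) g = \<i> / 4 * (2 * of_int (2 * m)) * \<nu> (PS_basis \<tau> (2 * m)) g
     + (- \<i> / 4 * (\<tau> - 1 + of_int (2 * m)) * \<nu> (PS_basis \<tau> (2 * (m - 1))) g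
       + \<i> / 4 * (\<tau> - 1 - of_int (2 * m)) * \<nu> (PS_basis \<tau> (2 * (m + 1))) g)"
    unfolding PS_shear_def i
    by (simp only: PS_embeddingD(2)[OF emb] PS_embeddingD(3)[OF emb] PS_space_add PS_space_cmult e)
  also have "\<dots> = shear_op ((\<tau> - 1) / 2) (\<lambda>m. \<nu> (PS_basis \<tau> (2 * m)) g) m"
    by (simp add: shear_op_def field_simps)
  finally show ?thesis .
qed

text \<open>By equivariance \<open>\<nu>\<close> maps \<open>PS_quot\<close> to the difference
  quotient along the unipotent flow, and its continuity carries the limit of
  \<open>PS_quot_converges\<close> over.\<close>

lemma PS_embedding_has_derivative:
  assumes emb: "PS_embedding \<tau> \<nu>" and n: "even n"
  shows "((\<lambda>t. \<nu> (PS_basis \<tau> n) (unip t)) has_vector_derivative \<nu> (PS_shear \<tau> n) (unip t)) (at t)"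
proof -
  let ?A = "\<lambda>t. \<nu> (PS_basis \<tau> n) (unip t)" and ?D = "\<nu> (PS_shear \<tau> n) (unip t)"
  note e = PS_basis_in_PS_space[OF n, of \<tau>]
  have quot: "\<nu> (PS_quot s \<tau> n) (unip t) = of_real (1 / s) * ?A (t + s) + of_real (- (1 / s)) * ?A t" for s
  proof -
    have "\<nu> (\<lambda>x. PS_basis \<tau> n (shear s x)) (unip t) = ?A (t + s)"
      using PS_embeddingD(5)[OF emb e unip_in_GL2R unip_in_GL2R, of s t]
      by (simp only: PS_action_unip unip_mult)
    then show ?thesis unfolding PS_quot_def
      by (simp only: PS_embeddingD(2)[OF emb] PS_embeddingD(3)[OF emb] PS_space_add PS_space_cmult PS_space_shear e)
  qed
  have "((\<lambda>s. \<nu> (PS_quot s \<tau> n) (unip t)) \<longlongrightarrow> ?D) (at 0)"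
    unfolding LIMSEQ_SEQ_conv[symmetric]
  proof (intro allI impI)
    fix s :: "nat \<Rightarrow> real" assume "(\<forall>j. s j \<noteq> 0) \<and> s \<longlonglongrightarrow> 0"
    then have "filterlim s (at 0) sequentially" by (auto simp: filterlim_at)
    from PS_embeddingD(4)[OF emb PS_quot_in_PS_space[OF n] PS_shear_in_PS_space[OF n] PS_quot_converges[OF this]]
    have "uniform_limit {unip t} (\<lambda>j. \<nu> (PS_quot (s j) \<tau> n)) (\<nu> (PS_shear \<tau> n)) sequentially"
      by (rule Cinf_convergesD) (auto simp: unip_in_GL2R)
    then show "(\<lambda>j. \<nu> (PS_quot (s j) \<tau> n) (unip t)) \<longlonglongrightarrow> ?D"
      by (rule tendsto_uniform_limitI) simp
  qed
  then have lim: "((\<lambda>s. norm (\<nu> (PS_quot s \<tau> n) (unip t) - ?D)) \<longlongrightarrow> 0) (at 0)"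
    by (rule tendsto_norm_zero[OF LIM_zero])
  have "norm (\<nu> (PS_quot s \<tau> n) (unip t) - ?D) = norm (?A (t + s) - ?A t - s *\<^sub>R ?D) / norm s"
    if "s \<noteq> 0" for s
  proof -
    have "\<nu> (PS_quot s \<tau> n) (unip t) - ?D = (?A (t + s) - ?A t - s *\<^sub>R ?D) / of_real s"
      using that by (simp add: quot scaleR_conv_of_real field_simps)
    then show ?thesis by (simp add: norm_divide)
  qed
  then have "\<forall>\<^sub>F s in at 0. norm (\<nu> (PS_quot s \<tau> n) (unip t) - ?D) = norm (?A (t + s) - ?A t - s *\<^sub>R ?D) / norm s"
    unfolding eventually_at by (intro exI[of _ 1]) auto
  from Lim_transform_eventually[OF lim this]
  have "((\<lambda>s. norm (?A (t + s) - ?A t - s *\<^sub>R ?D) / norm s) \<longlongrightarrow> 0) (at 0)" .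
  then show ?thesis
    unfolding has_vector_derivative_def has_derivative_at by (simp add: bounded_linear_scaleR_left)
qed

text \<open>Cuspidality applies to each right translate of \<open>\<phi>\<close>, hence to finite
  combinations, and passes to the limit because convergence is uniform on the compact
  segment.\<close>

lemma generated_rep_has_integral_0:
  assumes cusp: "cuspidal \<phi>" and smooth: "\<phi> \<in> Cinf_Gamma_G" and F: "F \<in> generated_rep \<phi>"
  shows "((\<lambda>t. F (unip t)) has_integral 0) {0..1}"
proof -
  obtain P where P: "\<And>j. \<exists>S c. finite S \<and> S \<subseteq> GL2R \<and> P j = (\<lambda>h. \<Sum>g\<in>S. c g * \<phi> (h ** g))"
    and conv: "Cinf_converges GL2R P F"
    using F unfolding generated_rep_def by blast
  have cont: "continuous_on {0..1} (\<lambda>t. \<phi> (unip t ** g))" if g: "g \<in> GL2R" for g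
  proof (rule continuous_on_compose2[where g = \<phi> and f = "\<lambda>t. unip t ** g" and t = GL2R])
    show "continuous_on GL2R \<phi>"
      using smooth Cinf_on_imp_continuous_on[of GL2R \<phi> "[]"] by (simp add: Cinf_Gamma_G_def)
    show "continuous_on {0..1} (\<lambda>t. unip t ** g)" by (rule continuous_on_unip_mult)
    show "(\<lambda>t. unip t ** g) ` {0..1} \<subseteq> GL2R"
      using g unip_in_GL2R by (auto simp: GL2R_def intro: invertible_mult)
  qed
  have int: "((\<lambda>t. P j (unip t)) has_integral 0) {0..1}" and contP: "continuous_on {0..1} (\<lambda>t. P j (unip t))" for j
  proof -
    obtain S c where S: "finite S" "S \<subseteq> GL2R" "P j = (\<lambda>h. \<Sum>g\<in>S. c g * \<phi> (h ** g))"
      using P[of j] by blast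
    have "((\<lambda>t. \<phi> (unip t ** g)) has_integral 0) {0..1}" if "g \<in> S" for g
    proof -
      have g: "g \<in> GL2R" using S(2) that by auto
      then have "integral {0..1} (\<lambda>t. \<phi> (unip t ** g)) = 0" using cusp by (simp add: cuspidal_def)
      \<comment> \<open>\<open>integral\<close> is 0 by default for functions that are not
        integrable; continuity turns the cuspidality equation into a \<open>has_integral\<close>
        fact.\<close>
      with integrable_integral[OF integrable_continuous_real[OF cont[OF g]]] show ?thesis by simp
    qed
    from has_integral_sum[OF S(1) has_integral_mult_right[OF this]]
    show "((\<lambda>t. P j (unip t)) has_integral 0) {0..1}" by (simp add: S(3))
    show "continuous_on {0..1} (\<lambda>t. P j (unip t))"
      unfolding S(3) using S(2) by (intro continuous_intros cont) auto
  qed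
  have "uniform_limit (unip ` {0..1}) P F sequentially"
    by (rule Cinf_convergesD[OF conv])
      (auto simp: unip_in_GL2R intro!: compact_continuous_image continuous_on_unip)
  then have "uniform_limit {0..1} (\<lambda>j t. P j (unip t)) (\<lambda>t. F (unip t)) sequentially"
    unfolding uniform_limit_iff by auto
  from uniform_limit_integral[OF this contP]
  obtain I J where IJ: "\<And>j. ((\<lambda>t. P j (unip t)) has_integral I j) {0..1}"
    "((\<lambda>t. F (unip t)) has_integral J) {0..1}" "I \<longlonglongrightarrow> J"
    by auto
  have "I = (\<lambda>j. 0)" using has_integral_unique[OF IJ(1) int] by (rule ext)
  then have "J = 0" using IJ(3) by (simp add: LIMSEQ_const_iff)
  with IJ(2) show ?thesis by simp
qed

theorem theorem1p2:
  fixes \<tau> :: complex and \<phi> :: "real^2^2 \<Rightarrow> complex"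
    and \<nu> :: "(real^2 \<Rightarrow> complex) \<Rightarrow> real^2^2 \<Rightarrow> complex" and c :: real
  assumes "Hecke_Maass_cusp_form \<phi>"
    and "c > 0" and "L2_norm_Gamma_G c \<phi> = 1"
    and "PS_embedding \<tau> \<nu>" and "\<nu> (PS_basis \<tau> 0) = \<phi>"
    and "\<nu> ` PS_space \<tau> \<subseteq> generated_rep \<phi>"
  shows "\<exists>\<sigma>::real.
      (\<forall>w. Re w > \<sigma> \<longrightarrow> D_E_term (PS_coeff \<tau> \<nu>) w summable_on {n. even n \<and> n \<noteq> 0})
      \<and> (\<exists>F. F holomorphic_on UNIV \<and> (\<forall>w. Re w > \<sigma> \<longrightarrow> F w = D_E_tilde (PS_coeff \<tau> \<nu>) w))"
proof -
  note emb = \<open>PS_embedding \<tau> \<nu>\<close>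
  define A where "A m t = \<nu> (PS_basis \<tau> (2 * m)) (unip t)" for m t
  obtain M C where growth: "\<forall>m. \<forall>t\<in>{0..1}. norm (A m t) \<le> C * (1 + real_of_int \<bar>m\<bar>) powr M"
    using PS_embedding_growth[OF emb] unfolding A_def by blast
  have der: "(A m has_vector_derivative shear_op ((\<tau> - 1) / 2) (\<lambda>m. A m t) m) (at t within {0..1})" for m t
    using PS_embedding_has_derivative[OF emb, of "2 * m" t] unfolding PS_embedding_shear[OF emb] A_def
    by (rule has_vector_derivative_at_within) simp
  have mean: "(A m has_integral 0) {0..1}" for m
  proof -
    have "\<nu> (PS_basis \<tau> (2 * m)) \<in> generated_rep \<phi>"
      using \<open>\<nu> ` PS_space \<tau> \<subseteq> generated_rep \<phi>\<close> PS_basis_in_PS_space[of "2 * m" \<tau>] by auto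
    then show ?thesis
      unfolding A_def using \<open>Hecke_Maass_cusp_form \<phi>\<close>
      by (intro generated_rep_has_integral_0) (auto simp: Hecke_Maass_cusp_form_def)
  qed
  have "shear_flow ((\<tau> - 1) / 2) M A"
    unfolding shear_flow_def using der mean growth by blast
  then obtain F where F: "F holomorphic_on UNIV"
    "\<And>w. Re w > M + 2 \<Longrightarrow> (\<lambda>m. A m 0 * abs_powr_symbol w m) summable_on UNIV"
    "\<And>w. Re w > M + 2 \<Longrightarrow> F w = (\<Sum>\<^sub>\<infinity>m. A m 0 * abs_powr_symbol w m)"
    using shear_flow_entire_continuation by blast
  let ?a = "PS_coeff \<tau> \<nu>" and ?E = "{n::int. even n \<and> n \<noteq> 0}"
  have bij: "bij_betw (\<lambda>m. 2 * m) (- {0}) ?E"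
    by (rule bij_betwI[of _ _ _ "\<lambda>n. n div 2"]) auto
  have tm: "D_E_term ?a w (2 * m) = A m 0 * abs_powr_symbol w m" if "m \<in> - {0}" for w m
    using that by (simp add: D_E_term_def PS_coeff_def A_def abs_powr_symbol_def unip_0)
  have DE: "D_E_term ?a w summable_on ?E \<and> D_E ?a w = F w" if w: "Re w > M + 2" for w
  proof -
    let ?f = "\<lambda>m. A m 0 * abs_powr_symbol w m"
    have s: "?f summable_on - {0}"
      by (rule summable_on_subset_banach[OF F(2)[OF w]]) simp
    then have "(\<lambda>m. D_E_term ?a w (2 * m)) summable_on - {0}"
      by (subst summable_on_cong[OF tm])
    then have 1: "D_E_term ?a w summable_on ?E"
      using summable_on_reindex_bij_betw[OF bij] by blast
    have "infsum (D_E_term ?a w) ?E = (\<Sum>\<^sub>\<infinity>m\<in>- {0}. D_E_term ?a w (2 * m))"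
      by (rule infsum_reindex_bij_betw[OF bij, symmetric])
    also have "\<dots> = infsum ?f (- {0})"
      by (rule infsum_cong[OF tm])
    \<comment> \<open>The term \<open>a 0\<close> is the summand at \<open>m = 0\<close>, since
      \<open>abs_powr_symbol w 0 = 1\<close> and \<open>unip 0 = mat 1\<close>.\<close>
    finally have "D_E ?a w = ?f 0 + infsum ?f (- {0})"
      by (simp add: D_E_def A_def PS_coeff_def abs_powr_symbol_def unip_0)
    also have "\<dots> = infsum ?f (insert 0 (- {0}))"
      using s by (subst infsum_insert) auto
    also have "insert 0 (- {0}) = (UNIV :: int set)" by auto
    finally show ?thesis using 1 F(3)[OF w] by simp
  qed
  \<comment> \<open>\<open>F\<close> continues \<open>D_E\<close> itself, and the prefactor is
    entire because \<open>rGamma\<close> is.\<close>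
  have "(\<lambda>w. 2 powr (w / 2) * rGamma ((1 - w) / 2) * F w) holomorphic_on UNIV"
    by (intro holomorphic_intros F(1)) auto
  then show ?thesis
    using DE unfolding D_E_tilde_def by (intro exI[of _ "M + 2"] conjI) auto
qed

end
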